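(* Let $0\le\alpha<2$. Let $X_\alpha=C_1^{\alpha}[0,1]$ if $\alpha\notin\{0,1\}$, and $X_\alpha=C^{\alpha}[0,1]$ if $\alpha\in\{0,1\}$. There exists a dense $G_\delta$ set $\mathcal G$ in $X_\alpha$ such that for any $f\in\mathcal G$ there exists a closed set $A\subseteq[0,1]$ such that $f|_A$ is convex and $\overline{\dim}_M A=1$.
   Context: For $0<\alpha<1$, $C_1^{\alpha}[0,1]$ is the set of functions $f:[0,1]\to\mathbb R$ with $|f(x)-f(y)|\le|x-y|^{\alpha}$ for all $x,y\in[0,1]$, with the metric $\|f-g\|_0$, where $\|h\|_0=\sup_{x\in[0,1]}|h(x)|$. For $1<\alpha<2$, $C_1^{\alpha}[0,1]$ is the set of differentiable functions $f:[0,1]\to\mathbb R$ with $|f'(x)-f'(y)|\le|x-y|^{\alpha-1}$ for all $x,y\in[0,1]$, with the metric $\|f-g\|_1$, where $\|h\|_1=\max\{\|h\|_0,\|h'\|_0\}$. $C^{0}[0,1]=C[0,1]$ is the space of continuous real functions with metric $\|f-g\|_0$, and $C^1[0,1]$ is the space of continuously differentiable real functions with metric $\|f-g\|_1$. For $A\subseteq[0,1]$, $f|_A$ is convex if for all $x_1<x_2<x_3$ in $A$ one has $\frac{f(x_2)-f(x_1)}{x_2-x_1}\le\frac{f(x_3)-f(x_2)}{x_3-x_2}$. For an integer $k\ge2$ let $\mathcal N_{k,\ell}(A)=\#\{j\in\mathbb Z: A\cap[\frac{j-1}{k^\ell},\frac{j}{k^\ell}]\ne\emptyset\}$. The upper Minkowski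 (box) dimension is $\overline{\dim}_M A=\limsup_{\ell\to\infty}\frac{\log\mathcal N_{k,\ell}(A)}{\ell\log k}$, which does not depend on $k$. *)

theory Defs
  imports "HOL-Analysis.Analysis"
begin

text \<open>
  A function on the unit interval is represented by a function on the reals that is
  \<^const>\<open>extensional\<close> on \<open>{0..1}\<close>, so that equality of representatives is equality on
  \<open>{0..1}\<close>. Derivatives are taken within \<open>{0..1}\<close>, hence one-sided at the end points.
\<close>

definition deriv01 :: "(real \<Rightarrow> real) \<Rightarrow> real \<Rightarrow> real" where
  "deriv01 f x = vector_derivative f (at x within {0..1})"

definition C0_01 :: "(real \<Rightarrow> real) set" where
  "C0_01 = {f \<in> extensional {0..1}. continuous_on {0..1} f}"

definition C1_01 :: "(real \<Rightarrow> real) set" where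
  "C1_01 = {f \<in> extensional {0..1}. f differentiable_on {0..1} \<and> continuous_on {0..1} (deriv01 f)}"

text \<open>\<open>C\<^sub>1\<^sup>\<alpha>[0,1]\<close>, meant for \<open>0 < \<alpha> < 1\<close> (first branch) and \<open>1 < \<alpha> < 2\<close> (second branch).\<close>

definition holder_ball :: "real \<Rightarrow> (real \<Rightarrow> real) set" where
  "holder_ball \<alpha> =
     (if \<alpha> < 1
      then {f \<in> extensional {0..1}.
              \<forall>x\<in>{0..1}. \<forall>y\<in>{0..1}. \<bar>f x - f y\<bar> \<le> \<bar>x - y\<bar> powr \<alpha>}
      else {f \<in> extensional {0..1}. f differentiable_on {0..1} \<and>
              (\<forall>x\<in>{0..1}. \<forall>y\<in>{0..1}. \<bar>deriv01 f x - deriv01 f y\<bar> \<le> \<bar>x - y\<bar> powr (\<alpha> - 1))})"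

definition X_carrier :: "real \<Rightarrow> (real \<Rightarrow> real) set" where
  "X_carrier \<alpha> = (if \<alpha> = 0 then C0_01 else if \<alpha> = 1 then C1_01 else holder_ball \<alpha>)"

definition sup_norm01 :: "(real \<Rightarrow> real) \<Rightarrow> real" where
  "sup_norm01 h = (SUP x\<in>{0..1}. \<bar>h x\<bar>)"

definition C1_norm01 :: "(real \<Rightarrow> real) \<Rightarrow> real" where
  "C1_norm01 h = max (sup_norm01 h) (sup_norm01 (deriv01 h))"

text \<open>The value \<open>0\<close> off the carrier only serves the locale \<^locale>\<open>Metric_space\<close>, which wants a
  non-negative symmetric distance on the whole type.\<close>

definition X_dist :: "real \<Rightarrow> (real \<Rightarrow> real) \<Rightarrow> (real \<Rightarrow> real) \<Rightarrow> real" where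
  "X_dist \<alpha> f g =
     (if f \<in> X_carrier \<alpha> \<and> g \<in> X_carrier \<alpha>
      then (if \<alpha> < 1 then sup_norm01 (\<lambda>x. f x - g x) else C1_norm01 (\<lambda>x. f x - g x))
      else 0)"

abbreviation X_topology :: "real \<Rightarrow> (real \<Rightarrow> real) topology" where
  "X_topology \<alpha> \<equiv> Metric_space.mtopology (X_carrier \<alpha>) (X_dist \<alpha>)"

text \<open>The library's \<^const>\<open>convex_on\<close> includes convexity of the domain, whereas \<open>A\<close> is an
  arbitrary set here.\<close>

definition convex_restricted :: "real set \<Rightarrow> (real \<Rightarrow> real) \<Rightarrow> bool" where
  "convex_restricted A f \<longleftrightarrow>
     (\<forall>x1\<in>A. \<forall>x2\<in>A. \<forall>x3\<in>A. x1 < x2 \<longrightarrow> x2 < x3 \<longrightarrow>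
        (f x2 - f x1) / (x2 - x1) \<le> (f x3 - f x2) / (x3 - x2))"

definition box_count :: "nat \<Rightarrow> nat \<Rightarrow> real set \<Rightarrow> nat" where
  "box_count k l A =
     card {j::int. A \<inter> {(real_of_int j - 1) / real k ^ l .. real_of_int j / real k ^ l} \<noteq> {}}"

text \<open>Meant for bounded \<open>A\<close>, where the counted index sets are finite. Since \<open>ln 0 = 0\<close>, the empty
  set receives dimension \<open>0\<close> instead of \<open>- \<infinity>\<close>.\<close>

definition upper_box_dim :: "nat \<Rightarrow> real set \<Rightarrow> ereal" where
  "upper_box_dim k A =
     limsup (\<lambda>l. ereal (ln (real (box_count k l A)) / (real l * ln (real k))))"


lemma deriv01_works:
  assumes "f differentiable_on {0..1}" "x \<in> {0..1}"
  shows "(f has_vector_derivative deriv01 f x) (at x within {0..1})"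
  using assms by (simp add: deriv01_def differentiable_on_def vector_derivative_works)

lemma deriv01_diff:
  assumes "f differentiable_on {0..1}" "g differentiable_on {0..1}" "x \<in> {0..1}"
  shows "deriv01 (\<lambda>x. f x - g x) x = deriv01 f x - deriv01 g x"
  unfolding deriv01_def[of "\<lambda>x. f x - g x"]
  by (rule vector_derivative_within_closed_interval)
     (use assms in \<open>auto intro!: has_vector_derivative_diff deriv01_works\<close>)

lemma continuous_on_powr_modulus:
  fixes h :: "real \<Rightarrow> real"
  assumes "0 < a" and h: "\<And>x y. x \<in> S \<Longrightarrow> y \<in> S \<Longrightarrow> \<bar>h x - h y\<bar> \<le> \<bar>x - y\<bar> powr a"
  shows "continuous_on S h"
  unfolding continuous_on_def
proof
  fix x assume x: "x \<in> S"
  have "((\<lambda>y. \<bar>y - x\<bar> powr a) \<longlongrightarrow> \<bar>x - x\<bar> powr a) (at x within S)"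
  proof (rule tendsto_powr2)
    show "((\<lambda>y. \<bar>y - x\<bar>) \<longlongrightarrow> \<bar>x - x\<bar>) (at x within S)"
      by (intro tendsto_intros)
  qed (use \<open>0 < a\<close> in auto)
  then have lim0: "((\<lambda>y. \<bar>y - x\<bar> powr a) \<longlongrightarrow> 0) (at x within S)"
    by simp
  have "((\<lambda>y. h y - h x) \<longlongrightarrow> 0) (at x within S)"
    by (rule Lim_null_comparison[OF _ lim0]) (use x h in \<open>auto simp: eventually_at_filter\<close>)
  then show "(h \<longlongrightarrow> h x) (at x within S)"
    by (simp add: LIM_zero_iff)
qed

lemma X_carrier_extensional: "f \<in> X_carrier \<alpha> \<Longrightarrow> f \<in> extensional {0..1}"
  by (auto simp: X_carrier_def C0_01_def C1_01_def holder_ball_def split: if_splits)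

lemma X_carrier_differentiable:
  assumes "1 \<le> \<alpha>" "f \<in> X_carrier \<alpha>"
  shows "f differentiable_on {0..1}"
  using assms by (auto simp: X_carrier_def C1_01_def holder_ball_def split: if_splits)

lemma X_carrier_continuous_deriv01:
  assumes "1 \<le> \<alpha>" "f \<in> X_carrier \<alpha>"
  shows "continuous_on {0..1} (deriv01 f)"
proof (cases "\<alpha> = 1")
  case True
  then show ?thesis using assms by (simp add: X_carrier_def C1_01_def)
next
  case False
  then show ?thesis using assms
    by (intro continuous_on_powr_modulus[of "\<alpha> - 1"]) (auto simp: X_carrier_def holder_ball_def)
qed

lemma X_carrier_continuous:
  assumes "0 \<le> \<alpha>" "f \<in> X_carrier \<alpha>"
  shows "continuous_on {0..1} f"
proof -
  consider "\<alpha> = 0" | "0 < \<alpha>" "\<alpha> < 1" | "1 \<le> \<alpha>" using assms by linarith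
  then show ?thesis
  proof cases
    case 1 then show ?thesis using assms by (simp add: X_carrier_def C0_01_def)
  next
    case 2 then show ?thesis using assms
      by (intro continuous_on_powr_modulus[of \<alpha>]) (auto simp: X_carrier_def holder_ball_def)
  next
    case 3 then show ?thesis
      using X_carrier_differentiable assms differentiable_imp_continuous_on by blast
  qed
qed

lemma bdd_sup_norm01:
  fixes h :: "real \<Rightarrow> real"
  assumes "continuous_on {0..1} h"
  shows "bdd_above ((\<lambda>x. \<bar>h x\<bar>) ` {0..1})"
  by (intro bounded_imp_bdd_above compact_imp_bounded compact_continuous_image)
     (use assms in \<open>auto intro!: continuous_intros\<close>)

lemma sup_norm01_upper:
  assumes "continuous_on {0..1} h" "x \<in> {0..1}"
  shows "\<bar>h x\<bar> \<le> sup_norm01 h"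
  unfolding sup_norm01_def using assms by (intro cSUP_upper bdd_sup_norm01)

lemma sup_norm01_nonneg:
  assumes "continuous_on {0..1} h"
  shows "0 \<le> sup_norm01 h"
  using sup_norm01_upper[OF assms, of 0] by simp

lemma sup_norm01_cong:
  assumes "\<And>x. x \<in> {0..1} \<Longrightarrow> \<bar>h x\<bar> = \<bar>h' x\<bar>"
  shows "sup_norm01 h = sup_norm01 h'"
  unfolding sup_norm01_def using assms by (intro SUP_cong) auto

lemma sup_norm01_triangle:
  assumes "continuous_on {0..1} g" "continuous_on {0..1} h"
    and "\<And>x. x \<in> {0..1} \<Longrightarrow> f x = g x + h x"
  shows "sup_norm01 f \<le> sup_norm01 g + sup_norm01 h"
  unfolding sup_norm01_def[of f]
proof (rule cSUP_least)
  fix x :: real assume x: "x \<in> {0..1}"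
  show "\<bar>f x\<bar> \<le> sup_norm01 g + sup_norm01 h"
    using sup_norm01_upper[OF assms(1) x] sup_norm01_upper[OF assms(2) x] assms(3)[OF x]
    by linarith
qed auto

lemma X_dist_altdef:
  assumes "f \<in> X_carrier \<alpha>" "g \<in> X_carrier \<alpha>"
  shows "X_dist \<alpha> f g =
     (if \<alpha> < 1 then sup_norm01 (\<lambda>x. f x - g x)
      else max (sup_norm01 (\<lambda>x. f x - g x)) (sup_norm01 (\<lambda>x. deriv01 f x - deriv01 g x)))"
proof (cases "\<alpha> < 1")
  case True
  then show ?thesis using assms by (simp add: X_dist_def)
next
  case False
  then have "sup_norm01 (deriv01 (\<lambda>x. f x - g x)) = sup_norm01 (\<lambda>x. deriv01 f x - deriv01 g x)"
    using assms X_carrier_differentiable[of \<alpha>] by (intro sup_norm01_cong) (simp add: deriv01_diff)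
  then show ?thesis using assms False by (simp add: X_dist_def C1_norm01_def)
qed

lemma Metric_space_X:
  assumes "0 \<le> \<alpha>"
  shows "Metric_space (X_carrier \<alpha>) (X_dist \<alpha>)"
proof -
  have cont: "continuous_on {0..1} (\<lambda>x. f x - g x)"
    if "f \<in> X_carrier \<alpha>" "g \<in> X_carrier \<alpha>" for f g
    using that X_carrier_continuous[OF assms] by (intro continuous_intros) auto
  have cont': "continuous_on {0..1} (\<lambda>x. deriv01 f x - deriv01 g x)"
    if "\<not> \<alpha> < 1" "f \<in> X_carrier \<alpha>" "g \<in> X_carrier \<alpha>" for f g
    using that X_carrier_continuous_deriv01[of \<alpha>] by (intro continuous_intros) auto
  have le: "sup_norm01 (\<lambda>x. f x - g x) \<le> X_dist \<alpha> f g"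
    if "f \<in> X_carrier \<alpha>" "g \<in> X_carrier \<alpha>" for f g
    using that by (simp add: X_dist_altdef)
  show ?thesis
  proof
    fix f g
    show "0 \<le> X_dist \<alpha> f g"
      by (cases "f \<in> X_carrier \<alpha> \<and> g \<in> X_carrier \<alpha>")
         (use le sup_norm01_nonneg[OF cont] in \<open>force simp: X_dist_def\<close>)+
    have "sup_norm01 (\<lambda>x. f x - g x) = sup_norm01 (\<lambda>x. g x - f x)"
      "sup_norm01 (\<lambda>x. deriv01 f x - deriv01 g x) = sup_norm01 (\<lambda>x. deriv01 g x - deriv01 f x)"
      by (auto intro!: sup_norm01_cong)
    then show "X_dist \<alpha> f g = X_dist \<alpha> g f"
      by (cases "f \<in> X_carrier \<alpha> \<and> g \<in> X_carrier \<alpha>") (auto simp: X_dist_altdef, auto simp: X_dist_def)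
  next
    fix f g assume fg: "f \<in> X_carrier \<alpha>" "g \<in> X_carrier \<alpha>"
    show "X_dist \<alpha> f g = 0 \<longleftrightarrow> f = g"
    proof
      assume "X_dist \<alpha> f g = 0"
      then have "\<bar>f x - g x\<bar> \<le> 0" if "x \<in> {0..1}" for x
        using le[OF fg] sup_norm01_upper[OF cont[OF fg] that] by linarith
      then show "f = g"
        using fg by (intro extensionalityI[where A = "{0..1}"]) (auto simp: X_carrier_extensional)
    next
      assume "f = g"
      then show "X_dist \<alpha> f g = 0"
        using fg by (simp add: X_dist_altdef sup_norm01_def)
    qed
  next
    fix f g h assume f: "f \<in> X_carrier \<alpha>" and g: "g \<in> X_carrier \<alpha>" and h: "h \<in> X_carrier \<alpha>"
    have 1: "sup_norm01 (\<lambda>x. f x - h x) \<le> sup_norm01 (\<lambda>x. f x - g x) + sup_norm01 (\<lambda>x. g x - h x)"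
      by (rule sup_norm01_triangle) (use cont f g h in auto)
    have 2: "sup_norm01 (\<lambda>x. deriv01 f x - deriv01 h x)
        \<le> sup_norm01 (\<lambda>x. deriv01 f x - deriv01 g x) + sup_norm01 (\<lambda>x. deriv01 g x - deriv01 h x)"
      if "\<not> \<alpha> < 1"
      by (rule sup_norm01_triangle) (use cont' that f g h in auto)
    show "X_dist \<alpha> f h \<le> X_dist \<alpha> f g + X_dist \<alpha> g h"
      using 1 2 f g h by (auto simp: X_dist_altdef)
  qed
qed

end

theory Submission
  imports Defs
begin

text \<open>
  Everything happens near the point \<open>0\<close>. Suppose that \<open>g\<close> is, on some interval \<open>[0, \<eta>]\<close>, strictly convex
  with slopes that either start at \<open>- \<infinity>\<close> (if \<open>\<alpha> < 1\<close>) or strictly exceed \<open>g'(0)\<close> (if \<open>\<alpha> \<ge> 1\<close>). Then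
  every arithmetic progression \<open>{0, h, \<dots>, N h}\<close> close to \<open>0\<close>, here called a comb, carries finitely many
  strict inequalities between values of \<open>g\<close> (and \<open>g'(0)\<close>), and these survive small perturbations of \<open>g\<close>. So
  the set of all \<open>f\<close> that are strictly convex on some comb in \<open>[0, 1/(n+1))\<close> with very many teeth, and
  whose slopes on this comb are below \<open>- n\<close> (if \<open>\<alpha> < 1\<close>) or exceed \<open>f'(0)\<close> (if \<open>\<alpha> \<ge> 1\<close>), is open; \<open>\<G>\<close> is the
  intersection of these sets over all \<open>n\<close> (\<open>convex_comb_layer\<close>, \<open>openin_convex_comb_layer\<close>).

  The set \<open>\<G>\<close> is dense, because functions \<open>g\<close> as above lie in all these sets at once
  (\<open>in_convex_comb_layer_if_derivative_strict_mono\<close>) and can be found arbitrarily close to any \<open>f\<close>. Shift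
  the argument by \<open>\<eta>\<close>, extending \<open>f\<close> to the left by its value at \<open>0\<close>, so that the function becomes constant on
  \<open>[0, \<eta>]\<close>; shrink it by the factor \<open>1 - t\<close>; then add \<open>- t x\<^sup>\<gamma>\<close> with \<open>\<alpha> < \<gamma> < 1\<close>, which is strictly convex
  with slope \<open>- \<infinity>\<close> at \<open>0\<close>. None of this breaks the Hoelder bound, as \<open>x\<^sup>\<gamma>\<close> satisfies it itself on
  \<open>[0,1]\<close>. For \<open>\<alpha> \<ge> 1\<close> the same is done to \<open>f'\<close> with \<open>+ t x\<^sup>\<gamma>\<close>, and the result is integrated (\<open>perturb\<close>,
  \<open>exists_near_in_all_layers_less_1\<close>, \<open>exists_near_in_all_layers_ge_1\<close>, \<open>closure_of_layers\<close>).

  Finally let \<open>f \<in> \<G>\<close>, with one comb for every \<open>n\<close>. If finitely many of the combs already have a union \<open>B\<close>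
  on which \<open>f\<close> is strictly convex, then a comb with sufficiently large \<open>n\<close> can be added: it lies to the
  left of all positive points of \<open>B\<close>, and its slopes are smaller than those from \<open>0\<close> to
  positive points of \<open>B\<close>, because they tend to \<open>- \<infinity>\<close> or to \<open>f'(0)\<close> and, in the second case, those from \<open>0\<close>
  exceed \<open>f'(0)\<close> (\<open>eventually_slopes_below\<close>,
  \<open>eventually_strictly_convex_Un\<close>). The union \<open>A\<close> of infinitely many combs obtained in this way accumulates only
  at \<open>0 \<in> A\<close>, so it is closed (\<open>exists_convex_union\<close>). A comb with gap \<open>h\<close> meets at least \<open>N\<close> boxes of length about
  \<open>h\<close>, and \<open>N\<close> is at least \<open>(1/h)\<^bsup>n/(n+1)\<^esup>\<close>; hence \<open>A\<close> has upper box dimension \<open>1\<close>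
  (\<open>upper_box_dim_ge_1\<close>, \<open>exists_convex_set_of_dim_1\<close>).
\<close>

section \<open>Slopes, derivatives and powers on the unit interval\<close>

definition slope :: "(real \<Rightarrow> real) \<Rightarrow> real \<Rightarrow> real \<Rightarrow> real" where
  "slope f u v = (f v - f u) / (v - u)"

lemma slope_eq_derivative:
  assumes "continuous_on {u..v} f" "u < v"
    and deriv: "\<And>x. u < x \<Longrightarrow> x < v \<Longrightarrow> (f has_real_derivative d x) (at x)"
  obtains z where "u < z" "z < v" "slope f u v = d z"
proof -
  obtain l z where z: "u < z" "z < v" "DERIV f z :> l" "f v - f u = (v - u) * l"
    using MVT[OF assms(2,1)] deriv real_differentiable_def by blast
  then have "l = d z" using deriv DERIV_unique by blast
  then show ?thesis using z that assms(2) by (auto simp: slope_def)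
qed

lemma has_vector_derivative_restrict_integral:
  fixes p :: "real \<Rightarrow> real"
  assumes p: "continuous_on {0..1} p" and x: "x \<in> {0..1}"
  shows "(restrict (\<lambda>x. c + integral {0..x} p) {0..1} has_vector_derivative p x) (at x within {0..1})"
proof (rule has_vector_derivative_transform[OF x])
  show "((\<lambda>x. c + integral {0..x} p) has_vector_derivative p x) (at x within {0..1})"
    using has_vector_derivative_add[OF has_vector_derivative_const integral_has_vector_derivative[OF p x]]
    by simp
qed simp

lemma abs_diff_le_if_deriv01_close:
  assumes f: "f differentiable_on {0..1}" and g: "g differentiable_on {0..1}"
    and close: "\<And>y. y \<in> {0..1} \<Longrightarrow> \<bar>deriv01 f y - deriv01 g y\<bar> \<le> e"
    and "f 0 = g 0" and x: "x \<in> {0..1}"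
  shows "\<bar>f x - g x\<bar> \<le> e"
proof -
  have "norm ((f x - g x) - (f 0 - g 0)) \<le> e * norm (x - 0)"
  proof (rule field_differentiable_bound)
    show "((\<lambda>x. f x - g x) has_real_derivative deriv01 f y - deriv01 g y) (at y within {0..1})"
      if "y \<in> {0..1}" for y
      using has_vector_derivative_diff[OF deriv01_works[OF f that] deriv01_works[OF g that]]
      by (simp add: has_real_derivative_iff_has_vector_derivative)
  qed (use close x in simp_all)
  also have "e * norm (x - 0) \<le> e * 1"
    using x close[OF x] by (intro mult_left_mono) simp_all
  finally show ?thesis using \<open>f 0 = g 0\<close> by simp
qed

lemma filterlim_neg_powr_derivative_at_bot:
  fixes \<gamma> t :: real
  assumes \<gamma>: "0 < \<gamma>" "\<gamma> < 1" and t: "0 < t"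
  shows "filterlim (\<lambda>x. - t * (\<gamma> * x powr (\<gamma> - 1))) at_bot (at_right 0)"
proof -
  have "((\<lambda>x::real. x powr (1 - \<gamma>)) \<longlongrightarrow> 0 powr (1 - \<gamma>)) (at_right 0)"
    by (rule tendsto_powr2)
       (use \<gamma> in \<open>auto intro!: tendsto_intros eventually_at_right_less[THEN eventually_mono]\<close>)
  then have "filterlim (\<lambda>x::real. inverse (x powr (1 - \<gamma>))) at_top (at_right 0)"
    by (intro filterlim_inverse_at_top)
       (use \<gamma> in \<open>auto intro!: eventually_at_right_less[THEN eventually_mono]\<close>)
  then have "filterlim (\<lambda>x::real. x powr (\<gamma> - 1)) at_top (at_right 0)"
    by (simp flip: powr_minus)
  moreover have "- t * \<gamma> < 0" using t \<gamma> by simp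
  ultimately have "filterlim (\<lambda>x::real. (- t * \<gamma>) * x powr (\<gamma> - 1)) at_bot (at_right 0)"
    by (intro filterlim_tendsto_neg_mult_at_bot[OF tendsto_const])
  then show ?thesis by (simp add: mult.assoc)
qed

lemma abs_powr_diff_le:
  fixes x y \<gamma> :: real
  assumes "0 \<le> x" "0 \<le> y" "0 < \<gamma>" "\<gamma> \<le> 1"
  shows "\<bar>x powr \<gamma> - y powr \<gamma>\<bar> \<le> \<bar>x - y\<bar> powr \<gamma>"
proof -
  have sub: "v powr \<gamma> - u powr \<gamma> \<le> (v - u) powr \<gamma>" if uv: "0 \<le> u" "u \<le> v" for u v
  proof (cases "v = 0")
    case False
    then have v: "0 < v" using uv by simp
    \<comment> \<open>After division by \<open>v\<^sup>\<gamma>\<close>, subadditivity is \<open>1 = r + (1 - r) \<le> r\<^sup>\<gamma> + (1 - r)\<^sup>\<gamma>\<close> for \<open>r = u / v\<close>.\<close>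
    have "u / v \<le> (u / v) powr \<gamma>" "(v - u) / v \<le> ((v - u) / v) powr \<gamma>"
      using powr_mono'[of \<gamma> 1 "u / v"] powr_mono'[of \<gamma> 1 "(v - u) / v"] uv v assms by auto
    moreover have "u / v + (v - u) / v = 1" using v by (simp add: field_simps)
    ultimately have "1 \<le> (u powr \<gamma> + (v - u) powr \<gamma>) / v powr \<gamma>"
      by (simp add: powr_divide add_divide_distrib)
    then show ?thesis using v by (simp add: le_divide_eq split: if_splits)
  qed (use uv in auto)
  show ?thesis
  proof (cases "x \<le> y")
    case True
    then have "x powr \<gamma> \<le> y powr \<gamma>" using assms by (intro powr_mono2) auto
    then show ?thesis using sub[of x y] True assms by (simp add: abs_if)
  next
    case False
    then have "y powr \<gamma> \<le> x powr \<gamma>" using assms by (intro powr_mono2) auto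
    then show ?thesis using sub[of y x] False assms by (simp add: abs_if)
  qed
qed

lemma sup_norm01_le:
  assumes "\<And>x. x \<in> {0..1} \<Longrightarrow> \<bar>h x\<bar> \<le> e"
  shows "sup_norm01 h \<le> e"
  unfolding sup_norm01_def using assms by (intro cSUP_least) auto

section \<open>Perturbing a function near the origin\<close>

text \<open>Shifting by \<open>\<eta>\<close> makes \<open>q\<close> constant on \<open>[0, \<eta>]\<close>, without any smoothness of \<open>q\<close>, so that the term \<open>s x\<^sup>\<gamma>\<close>
  alone determines the shape there. The factor \<open>1 - \<bar>s\<bar>\<close> makes room for this term in the unit
  Hoelder ball.\<close>

definition perturb :: "real \<Rightarrow> real \<Rightarrow> real \<Rightarrow> (real \<Rightarrow> real) \<Rightarrow> real \<Rightarrow> real" where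
  "perturb \<eta> s \<gamma> q x = (1 - \<bar>s\<bar>) * q (max 0 (x - \<eta>)) + s * x powr \<gamma>"

text \<open>The map \<open>x \<mapsto> max 0 (x - \<eta>)\<close> does not increase distances, and \<open>\<bar>x - y\<bar>\<^sup>\<gamma> \<le> \<bar>x - y\<bar>\<^sup>a\<close> on \<open>[0,1]\<close>; so the perturbed
  function is a convex combination of two functions with the modulus, up to a sign.\<close>

lemma perturb_powr_modulus:
  assumes q: "\<And>x y. x \<in> {0..1} \<Longrightarrow> y \<in> {0..1} \<Longrightarrow> \<bar>q x - q y\<bar> \<le> \<bar>x - y\<bar> powr a"
    and a: "0 < a" "a \<le> \<gamma>" "\<gamma> \<le> 1" and s: "\<bar>s\<bar> \<le> 1" and \<eta>: "0 \<le> \<eta>"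
    and xy: "x \<in> {0..1}" "y \<in> {0..1}"
  shows "\<bar>perturb \<eta> s \<gamma> q x - perturb \<eta> s \<gamma> q y\<bar> \<le> \<bar>x - y\<bar> powr a"
proof -
  let ?x = "max 0 (x - \<eta>)" and ?y = "max 0 (y - \<eta>)"
  have "\<bar>q ?x - q ?y\<bar> \<le> \<bar>?x - ?y\<bar> powr a" using xy \<eta> by (intro q) auto
  also have "\<dots> \<le> \<bar>x - y\<bar> powr a" using a by (intro powr_mono2) auto
  finally have 1: "\<bar>q ?x - q ?y\<bar> \<le> \<bar>x - y\<bar> powr a" .
  have "\<bar>x powr \<gamma> - y powr \<gamma>\<bar> \<le> \<bar>x - y\<bar> powr \<gamma>"
    using xy a by (intro abs_powr_diff_le) auto
  also have "\<dots> \<le> \<bar>x - y\<bar> powr a" using xy a by (intro powr_mono') auto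
  finally have 2: "\<bar>x powr \<gamma> - y powr \<gamma>\<bar> \<le> \<bar>x - y\<bar> powr a" .
  have "perturb \<eta> s \<gamma> q x - perturb \<eta> s \<gamma> q y
      = (1 - \<bar>s\<bar>) * (q ?x - q ?y) + s * (x powr \<gamma> - y powr \<gamma>)"
    by (simp add: perturb_def algebra_simps)
  also have "\<bar>\<dots>\<bar> \<le> \<bar>(1 - \<bar>s\<bar>) * (q ?x - q ?y)\<bar> + \<bar>s * (x powr \<gamma> - y powr \<gamma>)\<bar>"
    by (rule abs_triangle_ineq)
  also have "\<dots> \<le> (1 - \<bar>s\<bar>) * \<bar>x - y\<bar> powr a + \<bar>s\<bar> * \<bar>x - y\<bar> powr a"
  proof (rule add_mono)
    have "0 \<le> 1 - \<bar>s\<bar>" using s by simp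
    then show "\<bar>(1 - \<bar>s\<bar>) * (q ?x - q ?y)\<bar> \<le> (1 - \<bar>s\<bar>) * \<bar>x - y\<bar> powr a"
      unfolding abs_mult by (simp only: abs_of_nonneg mult_left_mono[OF 1])
    show "\<bar>s * (x powr \<gamma> - y powr \<gamma>)\<bar> \<le> \<bar>s\<bar> * \<bar>x - y\<bar> powr a"
      unfolding abs_mult by (rule mult_left_mono[OF 2 abs_ge_zero])
  qed
  finally show ?thesis by (simp add: algebra_simps)
qed

lemma continuous_on_perturb:
  assumes "continuous_on {0..1} q" "0 \<le> \<eta>" "0 < \<gamma>"
  shows "continuous_on {0..1} (perturb \<eta> s \<gamma> q)"
proof -
  have "continuous_on {0..1} (\<lambda>x. q (max 0 (x - \<eta>)))"
    using assms(2) by (intro continuous_on_compose2[OF assms(1)] continuous_intros) auto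
  moreover have "continuous_on {0..1} (\<lambda>x::real. x powr \<gamma>)"
    using assms(3) by (intro continuous_on_powr' continuous_intros) auto
  ultimately show ?thesis
    unfolding perturb_def by (intro continuous_on_add continuous_on_mult continuous_on_const)
qed

lemma perturb_close:
  assumes q: "continuous_on {0..1} q" and e: "0 < e" and \<gamma>: "0 \<le> \<gamma>"
  obtains \<eta> t where "0 < \<eta>" "\<eta> < 1" "0 < t" "t < 1"
    "\<And>s x. \<bar>s\<bar> = t \<Longrightarrow> x \<in> {0..1} \<Longrightarrow> \<bar>perturb \<eta> s \<gamma> q x - q x\<bar> \<le> e"
proof -
  define B where "B = sup_norm01 q"
  have B: "0 \<le> B" "\<And>x. x \<in> {0..1} \<Longrightarrow> \<bar>q x\<bar> \<le> B"
    using sup_norm01_nonneg[OF q] sup_norm01_upper[OF q] by (auto simp: B_def)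
  have "uniformly_continuous_on {0..1} q"
    using q by (intro compact_uniformly_continuous) auto
  then obtain d where d: "d > 0" "\<And>x y. x \<in> {0..1} \<Longrightarrow> y \<in> {0..1} \<Longrightarrow> dist y x < d \<Longrightarrow> dist (q y) (q x) < e/2"
    unfolding uniformly_continuous_on_def using e by (metis half_gt_zero)
  define \<eta> where "\<eta> = min (d/2) (1/2)"
  define t where "t = min (1/2) (e / (2 * (B + 1)))"
  have \<eta>: "0 < \<eta>" "\<eta> < 1" "\<eta> < d" using d(1) by (auto simp: \<eta>_def)
  have t: "0 < t" "t < 1" using e B by (auto simp: t_def)
  have "t \<le> e / (2 * (B + 1))" by (simp add: t_def)
  then have "t * (2 * (B + 1)) \<le> e" using B(1) by (subst (asm) pos_le_divide_eq) auto
  then have tB: "t * (B + 1) \<le> e / 2" by (simp add: algebra_simps)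
  have "\<bar>perturb \<eta> s \<gamma> q x - q x\<bar> \<le> e" if s: "\<bar>s\<bar> = t" and x: "x \<in> {0..1}" for s x
  proof -
    let ?x = "max 0 (x - \<eta>)"
    have "dist ?x x < d" using x \<eta> by (auto simp: dist_real_def max_def)
    moreover have "?x \<in> {0..1}" using x \<eta>(1) by auto
    ultimately have "dist (q ?x) (q x) < e/2" using x by (intro d(2))
    then have "\<bar>q ?x - q x\<bar> \<le> e/2" by (simp add: dist_real_def)
    have "perturb \<eta> s \<gamma> q x - q x = (1 - t) * (q ?x - q x) + (s * x powr \<gamma> - t * q x)"
      using s by (simp add: perturb_def algebra_simps)
    also have "\<bar>\<dots>\<bar> \<le> (1 - t) * \<bar>q ?x - q x\<bar> + (t * x powr \<gamma> + t * \<bar>q x\<bar>)"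
    proof -
      have "\<bar>a + (b - c)\<bar> \<le> \<bar>a\<bar> + (\<bar>b\<bar> + \<bar>c\<bar>)" for a b c :: real
        by linarith
      moreover have "\<bar>(1 - t) * (q ?x - q x)\<bar> = (1 - t) * \<bar>q ?x - q x\<bar>"
        "\<bar>s * x powr \<gamma>\<bar> = t * x powr \<gamma>" "\<bar>t * q x\<bar> = t * \<bar>q x\<bar>"
        using t s by (simp_all add: abs_mult)
      ultimately show ?thesis by metis
    qed
    also have "\<dots> \<le> 1 * (e/2) + (t * 1 + t * B)"
    proof (intro add_mono)
      show "(1 - t) * \<bar>q ?x - q x\<bar> \<le> 1 * (e/2)"
        using \<open>\<bar>q ?x - q x\<bar> \<le> e/2\<close> t by (intro mult_mono) simp_all
      have "x powr \<gamma> \<le> 1" using x \<gamma> by (intro powr_le1) simp_all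
      then show "t * x powr \<gamma> \<le> t * 1" using t(1) by (intro mult_left_mono) simp_all
      show "t * \<bar>q x\<bar> \<le> t * B" using B(2)[OF x] t(1) by (intro mult_left_mono) simp_all
    qed
    also have "\<dots> \<le> e" using tB by (simp add: algebra_simps)
    finally show ?thesis .
  qed
  then show ?thesis using that \<eta> t by blast
qed

lemma perturb_near_0: "x < \<eta> \<Longrightarrow> perturb \<eta> s \<gamma> q x = (1 - \<bar>s\<bar>) * q 0 + s * x powr \<gamma>"
  by (simp add: perturb_def)

lemma has_real_derivative_perturb_near_0:
  assumes x: "0 < x" "x < \<eta>"
  shows "(perturb \<eta> s \<gamma> q has_real_derivative s * (\<gamma> * x powr (\<gamma> - 1))) (at x)"
proof (rule has_field_derivative_transform_within_open)
  show "((\<lambda>x. (1 - \<bar>s\<bar>) * q 0 + s * x powr \<gamma>) has_real_derivative s * (\<gamma> * x powr (\<gamma> - 1))) (at x)"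
    using x(1) by (auto intro!: derivative_eq_intros)
  show "(1 - \<bar>s\<bar>) * q 0 + s * y powr \<gamma> = perturb \<eta> s \<gamma> q y" if "y \<in> {0<..<\<eta>}" for y
    using that by (simp add: perturb_near_0)
qed (use x in simp_all)

section \<open>The open layers\<close>

text \<open>Strict inequalities, unlike those of \<open>convex_restricted\<close>, persist when \<open>f\<close> is slightly changed
  at finitely many points; this makes the layers below open.\<close>

definition strictly_convex_restricted :: "real set \<Rightarrow> (real \<Rightarrow> real) \<Rightarrow> bool" where
  "strictly_convex_restricted A f \<longleftrightarrow>
     (\<forall>u\<in>A. \<forall>v\<in>A. \<forall>w\<in>A. u < v \<longrightarrow> v < w \<longrightarrow> slope f u v < slope f v w)"

definition slopes_below :: "real \<Rightarrow> real set \<Rightarrow> (real \<Rightarrow> real) \<Rightarrow> bool" where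
  "slopes_below L A f \<longleftrightarrow> (\<forall>u\<in>A. \<forall>v\<in>A. u < v \<longrightarrow> slope f u v < L)"

lemma strictly_convex_restrictedD:
  "strictly_convex_restricted A f \<Longrightarrow> u \<in> A \<Longrightarrow> v \<in> A \<Longrightarrow> w \<in> A \<Longrightarrow> u < v \<Longrightarrow> v < w
    \<Longrightarrow> slope f u v < slope f v w"
  unfolding strictly_convex_restricted_def by blast

lemma slopes_belowD:
  "slopes_below L A f \<Longrightarrow> u \<in> A \<Longrightarrow> v \<in> A \<Longrightarrow> u < v \<Longrightarrow> slope f u v < L"
  unfolding slopes_below_def by blast

definition comb :: "real \<Rightarrow> nat \<Rightarrow> real set" where
  "comb h N = (\<lambda>i. real i * h) ` {0..N}"

text \<open>The condition that makes the slopes on later combs drop below the slopes from \<open>0\<close> to a tooth of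
  this one. For \<open>\<alpha> \<ge> 1\<close> it refers to \<open>f'(0)\<close>, which depends continuously on \<open>f\<close> in the metric of the
  space; for \<open>\<alpha> < 1\<close> this derivative need not exist, and the slopes are driven to \<open>- \<infinity>\<close> instead.\<close>

definition steep_on :: "real \<Rightarrow> nat \<Rightarrow> real set \<Rightarrow> (real \<Rightarrow> real) \<Rightarrow> bool" where
  "steep_on \<alpha> n A f \<longleftrightarrow>
     (if \<alpha> < 1 then slopes_below (- real n) A f
      else \<forall>v\<in>A. 0 < v \<longrightarrow> deriv01 f 0 < slope f 0 v)"

text \<open>The last conjunct says \<open>N \<ge> (1/h)\<^bsup>n/(n+1)\<^esup>\<close>, a number of teeth of almost full dimension, without
  real exponents. It also excludes \<open>N = 0\<close>.\<close>

definition fine_comb :: "nat \<Rightarrow> real \<Rightarrow> nat \<Rightarrow> bool" where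
  "fine_comb n h N \<longleftrightarrow> 0 < h \<and> real N * h < 1 / real (Suc n) \<and> (1/h) ^ n \<le> real N ^ Suc n"

definition convex_comb_layer :: "real \<Rightarrow> nat \<Rightarrow> (real \<Rightarrow> real) set" where
  "convex_comb_layer \<alpha> n = {f \<in> X_carrier \<alpha>. \<exists>N h. fine_comb n h N \<and>
      strictly_convex_restricted (comb h N) f \<and> steep_on \<alpha> n (comb h N) f}"

lemma comb_subset:
  assumes "fine_comb n h N"
  shows "comb h N \<subseteq> {0..<1 / real (Suc n)}"
proof
  fix x assume "x \<in> comb h N"
  then obtain i where i: "i \<le> N" "x = real i * h" by (auto simp: comb_def)
  have h: "0 < h" "real N * h < 1 / real (Suc n)" using assms by (auto simp: fine_comb_def)
  have "real i * h \<le> real N * h" using i h by (intro mult_right_mono) auto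
  then have "x < 1 / real (Suc n)" using i h by linarith
  then show "x \<in> {0..<1 / real (Suc n)}" using i h by simp
qed

lemma zero_in_comb: "0 \<in> comb h N"
  by (force simp: comb_def)

lemma finite_comb: "finite (comb h N)"
  by (simp add: comb_def)

lemma comb_subset_01: "fine_comb n h N \<Longrightarrow> comb h N \<subseteq> {0..1}"
proof -
  assume "fine_comb n h N"
  moreover have "1 / real (Suc n) \<le> 1" by simp
  then have "{0..<1 / real (Suc n)} \<subseteq> {0..1}"
    by (meson atLeastLessThan_subseteq_atLeastAtMost_iff order_refl)
  ultimately show ?thesis using comb_subset by blast
qed

lemma abs_diff_le_X_dist:
  assumes "0 \<le> \<alpha>" "f \<in> X_carrier \<alpha>" "g \<in> X_carrier \<alpha>" "x \<in> {0..1}"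
  shows "\<bar>f x - g x\<bar> \<le> X_dist \<alpha> f g"
proof -
  have "\<bar>f x - g x\<bar> \<le> sup_norm01 (\<lambda>x. f x - g x)"
    using assms X_carrier_continuous by (intro sup_norm01_upper continuous_on_diff) auto
  then show ?thesis using assms by (simp add: X_dist_altdef le_max_iff_disj)
qed

lemma abs_diff_deriv01_le_X_dist:
  assumes "1 \<le> \<alpha>" "f \<in> X_carrier \<alpha>" "g \<in> X_carrier \<alpha>" "x \<in> {0..1}"
  shows "\<bar>deriv01 f x - deriv01 g x\<bar> \<le> X_dist \<alpha> f g"
proof -
  have "\<bar>deriv01 f x - deriv01 g x\<bar> \<le> sup_norm01 (\<lambda>x. deriv01 f x - deriv01 g x)"
    using assms X_carrier_continuous_deriv01
    by (intro sup_norm01_upper[of "\<lambda>x. deriv01 f x - deriv01 g x"] continuous_on_diff) auto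
  then show ?thesis using assms by (simp add: X_dist_altdef le_max_iff_disj)
qed

lemma topspace_X_topology: "0 \<le> \<alpha> \<Longrightarrow> topspace (X_topology \<alpha>) = X_carrier \<alpha>"
  by (simp add: Metric_space.topspace_mtopology Metric_space_X)

text \<open>Applied to point evaluations, and to the derivative at \<open>0\<close>.\<close>

lemma continuous_map_X_if_nonexpansive:
  assumes "0 \<le> \<alpha>"
    and le: "\<And>f g. f \<in> X_carrier \<alpha> \<Longrightarrow> g \<in> X_carrier \<alpha> \<Longrightarrow> \<bar>\<phi> f - \<phi> g\<bar> \<le> X_dist \<alpha> f g"
  shows "continuous_map (X_topology \<alpha>) euclideanreal \<phi>"
proof -
  interpret Metric_space "X_carrier \<alpha>" "X_dist \<alpha>"
    using assms(1) by (rule Metric_space_X)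
  show ?thesis
    unfolding continuous_map_from_metric
  proof (intro conjI ballI allI impI)
    fix f U assume f: "f \<in> X_carrier \<alpha>" and U: "openin euclideanreal U \<and> \<phi> f \<in> U"
    then obtain r where r: "r > 0" "ball (\<phi> f) r \<subseteq> U"
      by (auto simp: open_contains_ball)
    then show "\<exists>r>0. \<forall>g. g \<in> X_carrier \<alpha> \<and> X_dist \<alpha> f g < r \<longrightarrow> \<phi> g \<in> U"
      using le[OF f] by (intro exI[of _ r]) (force simp: dist_real_def subset_iff)
  qed auto
qed

lemma continuous_map_X_slope:
  assumes "0 \<le> \<alpha>" "u \<in> {0..1}" "v \<in> {0..1}"
  shows "continuous_map (X_topology \<alpha>) euclideanreal (\<lambda>f. slope f u v)"
proof -
  have "continuous_map (X_topology \<alpha>) euclideanreal (\<lambda>f. f x)" if "x \<in> {0..1}" for x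
    using assms that abs_diff_le_X_dist by (intro continuous_map_X_if_nonexpansive) auto
  then have "continuous_map (X_topology \<alpha>) euclideanreal (\<lambda>f. (f v - f u) * (1 / (v - u)))"
    using assms by (intro continuous_map_real_mult continuous_map_diff) auto
  then show ?thesis by (simp add: slope_def)
qed

lemma openin_Collect_less:
  assumes "continuous_map T euclideanreal \<phi>" "continuous_map T euclideanreal \<psi>"
  shows "openin T {x \<in> topspace T. \<phi> x < \<psi> x}"
proof -
  have "openin T {x \<in> topspace T. \<psi> x - \<phi> x \<in> {0<..}}"
    by (intro openin_continuous_map_preimage[where Y = euclideanreal] continuous_map_diff assms) auto
  then show ?thesis by simp
qed

lemma openin_Collect_ball_finite:
  assumes "finite A" "\<And>u. u \<in> A \<Longrightarrow> openin T {x \<in> topspace T. P u x}"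
  shows "openin T {x \<in> topspace T. \<forall>u\<in>A. P u x}"
  using assms
proof (induction A rule: finite_induct)
  case (insert a A)
  then have "openin T ({x \<in> topspace T. P a x} \<inter> {x \<in> topspace T. \<forall>u\<in>A. P u x})"
    by (intro openin_Int) auto
  also have "{x \<in> topspace T. P a x} \<inter> {x \<in> topspace T. \<forall>u\<in>A. P u x}
      = {x \<in> topspace T. \<forall>u\<in>insert a A. P u x}" by auto
  finally show ?case .
qed auto

lemma openin_Collect_imp_const:
  assumes "Q \<Longrightarrow> openin T {x \<in> topspace T. P x}"
  shows "openin T {x \<in> topspace T. Q \<longrightarrow> P x}"
  using assms by (cases Q) auto

text \<open>For a fixed comb, membership is a finite conjunction of strict inequalities between continuous
  functionals.\<close>

lemma openin_convex_comb_layer: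
  assumes "0 \<le> \<alpha>"
  shows "openin (X_topology \<alpha>) (convex_comb_layer \<alpha> n)"
proof -
  let ?T = "X_topology \<alpha>"
  have "openin ?T {f \<in> topspace ?T. strictly_convex_restricted (comb h N) f}"
    if "fine_comb n h N" for h N
    unfolding strictly_convex_restricted_def using comb_subset_01[OF that] assms
    by (intro openin_Collect_ball_finite openin_Collect_imp_const finite_comb openin_Collect_less
        continuous_map_X_slope) auto
  moreover have "openin ?T {f \<in> topspace ?T. steep_on \<alpha> n (comb h N) f}"
    if "fine_comb n h N" for h N
  proof (cases "\<alpha> < 1")
    case True
    have "openin ?T {f \<in> topspace ?T. slopes_below (- real n) (comb h N) f}"
      unfolding slopes_below_def using comb_subset_01[OF that] assms
      by (intro openin_Collect_ball_finite openin_Collect_imp_const finite_comb openin_Collect_less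
          continuous_map_X_slope) auto
    then show ?thesis using True by (simp add: steep_on_def)
  next
    case False
    have "continuous_map ?T euclideanreal (\<lambda>f. deriv01 f 0)"
      using False assms abs_diff_deriv01_le_X_dist
      by (intro continuous_map_X_if_nonexpansive) auto
    then have "openin ?T {f \<in> topspace ?T. \<forall>v\<in>comb h N. 0 < v \<longrightarrow> deriv01 f 0 < slope f 0 v}"
      using comb_subset_01[OF that] assms
      by (intro openin_Collect_ball_finite openin_Collect_imp_const finite_comb openin_Collect_less
          continuous_map_X_slope) auto
    then show ?thesis using False by (simp add: steep_on_def)
  qed
  ultimately have "openin ?T (\<Union>(h, N)\<in>{(h, N). fine_comb n h N}.
      {f \<in> topspace ?T. strictly_convex_restricted (comb h N) f} \<inter>
      {f \<in> topspace ?T. steep_on \<alpha> n (comb h N) f})"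
    by (intro openin_Union) (auto intro!: openin_Int)
  also have "(\<Union>(h, N)\<in>{(h, N). fine_comb n h N}.
      {f \<in> topspace ?T. strictly_convex_restricted (comb h N) f} \<inter>
      {f \<in> topspace ?T. steep_on \<alpha> n (comb h N) f}) = convex_comb_layer \<alpha> n"
    using assms by (auto simp: convex_comb_layer_def topspace_X_topology)
  finally show ?thesis .
qed

text \<open>By the mean value theorem the slopes of \<open>f\<close> are values of \<open>d\<close>, so \<open>f\<close> is strictly convex on every comb in
  \<open>[0, \<eta>)\<close>. It remains to choose one that is short and has enough teeth.\<close>

lemma in_convex_comb_layer_if_derivative_strict_mono:
  assumes \<alpha>: "0 \<le> \<alpha>" and f: "f \<in> X_carrier \<alpha>" and \<eta>: "0 < \<eta>" "\<eta> \<le> 1"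
    and deriv: "\<And>x. 0 < x \<Longrightarrow> x < \<eta> \<Longrightarrow> (f has_real_derivative d x) (at x)"
    and mono: "\<And>x y. 0 < x \<Longrightarrow> x < y \<Longrightarrow> y < \<eta> \<Longrightarrow> d x < d y"
    and lim: "\<alpha> < 1 \<Longrightarrow> filterlim d at_bot (at_right 0)"
    and above: "\<And>x. 1 \<le> \<alpha> \<Longrightarrow> 0 < x \<Longrightarrow> x < \<eta> \<Longrightarrow> deriv01 f 0 < d x"
  shows "f \<in> convex_comb_layer \<alpha> n"
proof -
  have cont: "continuous_on {u..v} f" if "0 \<le> u" "v < \<eta>" for u v
    using X_carrier_continuous[OF \<alpha> f] by (rule continuous_on_subset) (use that \<eta> in auto)
  have slope: "\<exists>z. u < z \<and> z < v \<and> slope f u v = d z" if uv: "0 \<le> u" "u < v" "v < \<eta>" for u v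
  proof -
    have "(f has_real_derivative d x) (at x)" if "u < x" "x < v" for x
      using deriv[of x] that \<open>0 \<le> u\<close> \<open>v < \<eta>\<close> by simp
    then obtain z where "u < z" "z < v" "slope f u v = d z"
      by (rule slope_eq_derivative[OF cont[OF uv(1,3)] uv(2)])
    then show ?thesis by blast
  qed
  have "\<exists>\<delta>>0. \<alpha> < 1 \<longrightarrow> (\<forall>x>0. x < \<delta> \<longrightarrow> d x < - real n)"
  proof (cases "\<alpha> < 1")
    case True
    then have "\<forall>\<^sub>F x in at_right 0. d x < - real n"
      using lim by (simp add: filterlim_at_bot_dense)
    then show ?thesis by (auto simp: eventually_at_right_field)
  qed (auto intro: exI[of _ 1])
  then obtain \<delta> where \<delta>: "\<delta> > 0" "\<And>x. \<alpha> < 1 \<Longrightarrow> 0 < x \<Longrightarrow> x < \<delta> \<Longrightarrow> d x < - real n"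
    by blast
  define c where "c = min (min \<eta> \<delta>) (1 / real (Suc n))"
  have c: "0 < c" "c \<le> \<eta>" "c \<le> \<delta>" "c \<le> 1 / real (Suc n)"
    using \<eta>(1) \<delta>(1) unfolding c_def by simp_all
  define b where "b = c / 2"
  have b: "0 < b" "b < \<eta>" "b < \<delta>" "b < 1 / real (Suc n)"
    using c unfolding b_def by linarith+
  \<comment> \<open>On a fixed length \<open>b = N h\<close>, the inequality \<open>(1/h)\<^sup>n \<le> N\<^bsup>n+1\<^esup>\<close> amounts to \<open>(1/b)\<^sup>n \<le> N\<close>.\<close>
  obtain N where N: "max 1 ((1 / b) ^ n) \<le> real N" using real_arch_simple by blast
  define h where "h = b / real N"
  have Nh: "real N * h = b" using N by (auto simp: h_def)
  have h: "0 < h" using N b by (auto simp: h_def)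
  have "(1/h) ^ n = (1/b) ^ n * real N ^ n"
    by (simp add: h_def power_divide)
  also have "\<dots> \<le> real N * real N ^ n" using N by (intro mult_right_mono) auto
  finally have fine: "fine_comb n h N"
    using Nh h b by (simp add: fine_comb_def)
  have sub: "0 \<le> x \<and> x \<le> b" if "x \<in> comb h N" for x
  proof -
    obtain i where i: "i \<le> N" "x = real i * h" using \<open>x \<in> comb h N\<close> by (auto simp: comb_def)
    have "real i * h \<le> real N * h" using i h by (intro mult_right_mono) auto
    then show ?thesis using i h Nh by simp
  qed
  have "strictly_convex_restricted (comb h N) f"
    unfolding strictly_convex_restricted_def
  proof (intro ballI impI)
    fix u v w assume uvw: "u \<in> comb h N" "v \<in> comb h N" "w \<in> comb h N" "u < v" "v < w"
    then have *: "0 \<le> u" "w \<le> b" using sub by auto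
    obtain y z where "u < y" "y < v" "slope f u v = d y" "v < z" "z < w" "slope f v w = d z"
      using slope[of u v] slope[of v w] * uvw(4,5) b(2) by auto
    then show "slope f u v < slope f v w" using mono[of y z] * uvw(4,5) b(2) by auto
  qed
  moreover have "steep_on \<alpha> n (comb h N) f"
  proof (cases "\<alpha> < 1")
    case True
    have "slope f u v < - real n" if "u \<in> comb h N" "v \<in> comb h N" "u < v" for u v
    proof -
      have *: "0 \<le> u" "v \<le> b" using sub that by auto
      obtain z where "u < z" "z < v" "slope f u v = d z"
        using slope[of u v] * \<open>u < v\<close> b(2) by auto
      then show ?thesis using \<delta>(2)[OF True, of z] * b by auto
    qed
    then show ?thesis using True by (auto simp: steep_on_def slopes_below_def)
  next
    case False
    have "deriv01 f 0 < slope f 0 v" if "v \<in> comb h N" "0 < v" for v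
    proof -
      have *: "v \<le> b" using sub that by auto
      obtain z where "0 < z" "z < v" "slope f 0 v = d z"
        using slope[of 0 v] * \<open>0 < v\<close> b(2) by auto
      then show ?thesis using above[of z] False * b by auto
    qed
    then show ?thesis using False by (auto simp: steep_on_def)
  qed
  ultimately show ?thesis
    using f fine by (auto simp: convex_comb_layer_def)
qed

section \<open>Approximation by functions in all layers\<close>

text \<open>With any exponent \<open>\<gamma>\<close> strictly between \<open>\<alpha>\<close> and \<open>1\<close>, the term \<open>- t x\<^sup>\<gamma>\<close> respects the Hoelder bound and has derivative
  \<open>- \<infinity>\<close> at \<open>0\<close>. The midpoint serves \<open>\<alpha> = 0\<close> as well.\<close>

lemma exists_near_in_all_layers_less_1:
  assumes \<alpha>: "0 \<le> \<alpha>" "\<alpha> < 1" and f: "f \<in> X_carrier \<alpha>" and e: "0 < e"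
  shows "\<exists>g \<in> \<Inter>n. convex_comb_layer \<alpha> n. X_dist \<alpha> f g \<le> e"
proof -
  define \<gamma> where "\<gamma> = (1 + \<alpha>) / 2"
  have \<gamma>: "0 < \<gamma>" "\<alpha> < \<gamma>" "\<gamma> < 1" using \<alpha> by (auto simp: \<gamma>_def)
  have cont: "continuous_on {0..1} f" using X_carrier_continuous \<alpha> f by blast
  obtain \<eta> t where \<eta>: "0 < \<eta>" "\<eta> < 1" and t: "0 < t" "t < 1"
    and close: "\<And>s x. \<bar>s\<bar> = t \<Longrightarrow> x \<in> {0..1} \<Longrightarrow> \<bar>perturb \<eta> s \<gamma> f x - f x\<bar> \<le> e"
    using perturb_close[OF cont e, of \<gamma>] \<gamma>(1) by auto
  define g where "g = restrict (perturb \<eta> (-t) \<gamma> f) {0..1}"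
  have g: "g x = perturb \<eta> (-t) \<gamma> f x" if "x \<in> {0..1}" for x using that by (simp add: g_def)
  have gX: "g \<in> X_carrier \<alpha>"
  proof (cases "\<alpha> = 0")
    case True
    have "continuous_on {0..1} g"
      by (rule continuous_on_eq[OF continuous_on_perturb[OF cont, of \<eta> \<gamma> "-t"]]) (use \<eta> \<gamma> g in auto)
    then show ?thesis using True by (simp add: X_carrier_def C0_01_def g_def)
  next
    case False
    have X: "X_carrier \<alpha> = {f \<in> extensional {0..1}.
        \<forall>x\<in>{0..1}. \<forall>y\<in>{0..1}. \<bar>f x - f y\<bar> \<le> \<bar>x - y\<bar> powr \<alpha>}"
      using False \<alpha>(2) by (simp add: X_carrier_def holder_ball_def)
    have f_modulus: "\<bar>f x - f y\<bar> \<le> \<bar>x - y\<bar> powr \<alpha>" if "x \<in> {0..1}" "y \<in> {0..1}" for x y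
      using f that unfolding X by blast
    have "\<bar>g x - g y\<bar> \<le> \<bar>x - y\<bar> powr \<alpha>" if xy: "x \<in> {0..1}" "y \<in> {0..1}" for x y
      unfolding g[OF xy(1)] g[OF xy(2)]
      using False \<alpha>(1) \<gamma> t \<eta>(1) by (intro perturb_powr_modulus[OF f_modulus] xy) simp_all
    moreover have "g \<in> extensional {0..1}" by (simp add: g_def)
    ultimately show ?thesis unfolding X by blast
  qed
  have "g \<in> convex_comb_layer \<alpha> n" for n
  proof (rule in_convex_comb_layer_if_derivative_strict_mono[OF \<alpha>(1) gX \<eta>(1)])
    let ?d = "\<lambda>x. - t * (\<gamma> * x powr (\<gamma> - 1))"
    show "(g has_real_derivative ?d x) (at x)" if x: "0 < x" "x < \<eta>" for x
      by (rule has_field_derivative_transform_within_open[OF has_real_derivative_perturb_near_0[OF x]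
            open_greaterThanLessThan, of 0 \<eta>]) (use x \<eta>(2) g in simp_all)
    show "?d x < ?d y" if "0 < x" "x < y" "y < \<eta>" for x y
      using that t \<gamma> powr_less_mono2_neg[of "\<gamma> - 1" x y] by simp
    show "filterlim ?d at_bot (at_right 0)"
      using \<gamma> t by (intro filterlim_neg_powr_derivative_at_bot)
  qed (use \<eta> \<alpha> in auto)
  moreover have "\<bar>f x - g x\<bar> \<le> e" if "x \<in> {0..1}" for x
    using close[of "-t" x] t that by (simp add: g abs_minus_commute)
  then have "X_dist \<alpha> f g \<le> e"
    using \<alpha> sup_norm01_le[of "\<lambda>x. f x - g x" e] by (simp add: X_dist_altdef[OF f gX])
  ultimately show ?thesis by blast
qed

text \<open>Perturbing \<open>f'\<close> instead of \<open>f\<close> makes the derivative near \<open>0\<close> a constant plus \<open>t x\<^sup>\<gamma>\<close>, hence strictly increasing. The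
  exponent \<open>\<gamma> = \<alpha> / 2\<close> is positive also for \<open>\<alpha> = 1\<close>, and \<open>\<alpha> - 1 \<le> \<gamma>\<close> because \<open>\<alpha> < 2\<close>.\<close>

lemma exists_near_in_all_layers_ge_1:
  assumes \<alpha>: "1 \<le> \<alpha>" "\<alpha> < 2" and f: "f \<in> X_carrier \<alpha>" and e: "0 < e"
  shows "\<exists>g \<in> \<Inter>n. convex_comb_layer \<alpha> n. X_dist \<alpha> f g \<le> e"
proof -
  define \<gamma> where "\<gamma> = \<alpha> / 2"
  have \<gamma>: "0 < \<gamma>" "\<alpha> - 1 \<le> \<gamma>" "\<gamma> < 1" using \<alpha> by (auto simp: \<gamma>_def)
  have cont: "continuous_on {0..1} (deriv01 f)" using X_carrier_continuous_deriv01 \<alpha> f by blast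
  have f_diff: "f differentiable_on {0..1}" using X_carrier_differentiable \<alpha> f by blast
  obtain \<eta> t where \<eta>: "0 < \<eta>" "\<eta> < 1" and t: "0 < t" "t < 1"
    and close: "\<And>s x. \<bar>s\<bar> = t \<Longrightarrow> x \<in> {0..1} \<Longrightarrow> \<bar>perturb \<eta> s \<gamma> (deriv01 f) x - deriv01 f x\<bar> \<le> e"
    using perturb_close[OF cont e, of \<gamma>] \<gamma>(1) by auto
  define p where "p = perturb \<eta> t \<gamma> (deriv01 f)"
  have p: "continuous_on {0..1} p"
    unfolding p_def using cont \<eta> \<gamma> by (intro continuous_on_perturb) auto
  have p_close: "\<bar>p x - deriv01 f x\<bar> \<le> e" if "x \<in> {0..1}" for x
    using close[of t x] that t by (simp add: p_def)
  define g where "g = restrict (\<lambda>x. f 0 + integral {0..x} p) {0..1}"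
  have g_deriv: "(g has_vector_derivative p x) (at x within {0..1})" if "x \<in> {0..1}" for x
    unfolding g_def by (rule has_vector_derivative_restrict_integral[OF p that])
  have deriv01_g: "deriv01 g x = p x" if "x \<in> {0..1}" for x
    unfolding deriv01_def
    by (rule vector_derivative_within_closed_interval) (use that g_deriv in auto)
  have g_diff: "g differentiable_on {0..1}"
    unfolding differentiable_on_def using g_deriv differentiableI_vector by blast
  have gX: "g \<in> X_carrier \<alpha>"
  proof (cases "\<alpha> = 1")
    case True
    have "continuous_on {0..1} (deriv01 g)"
      by (rule continuous_on_eq[OF p]) (use deriv01_g in auto)
    then show ?thesis using True g_diff by (simp add: X_carrier_def C1_01_def g_def)
  next
    case False
    have X: "X_carrier \<alpha> = {f \<in> extensional {0..1}. f differentiable_on {0..1} \<and>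
        (\<forall>x\<in>{0..1}. \<forall>y\<in>{0..1}. \<bar>deriv01 f x - deriv01 f y\<bar> \<le> \<bar>x - y\<bar> powr (\<alpha> - 1))}"
      using False \<alpha>(1) by (simp add: X_carrier_def holder_ball_def)
    have f_modulus: "\<bar>deriv01 f x - deriv01 f y\<bar> \<le> \<bar>x - y\<bar> powr (\<alpha> - 1)"
      if "x \<in> {0..1}" "y \<in> {0..1}" for x y
      using f that unfolding X by blast
    have "\<bar>deriv01 g x - deriv01 g y\<bar> \<le> \<bar>x - y\<bar> powr (\<alpha> - 1)"
      if xy: "x \<in> {0..1}" "y \<in> {0..1}" for x y
      unfolding deriv01_g[OF xy(1)] deriv01_g[OF xy(2)] p_def
      using False \<alpha>(1) \<gamma> t \<eta>(1) by (intro perturb_powr_modulus[OF f_modulus] xy) simp_all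
    moreover have "g \<in> extensional {0..1}" by (simp add: g_def)
    ultimately show ?thesis unfolding X using g_diff by blast
  qed
  have "g \<in> convex_comb_layer \<alpha> n" for n
  proof (rule in_convex_comb_layer_if_derivative_strict_mono[OF _ gX \<eta>(1)])
    show "(g has_real_derivative p x) (at x)" if x: "0 < x" "x < \<eta>" for x
      using g_deriv[of x] x \<eta>
      by (simp add: has_real_derivative_iff_has_vector_derivative at_within_Icc_at)
    show "p x < p y" if "0 < x" "x < y" "y < \<eta>" for x y
      using that t \<gamma> powr_less_mono2[of \<gamma> x y] by (simp add: p_def perturb_near_0)
    show "deriv01 g 0 < p x" if "0 < x" "x < \<eta>" for x
      using that t \<eta> by (simp add: deriv01_g) (simp add: p_def perturb_near_0)
  qed (use \<eta> \<alpha> in auto)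
  moreover have "\<bar>f x - g x\<bar> \<le> e" if x: "x \<in> {0..1}" for x
    by (rule abs_diff_le_if_deriv01_close[OF f_diff g_diff _ _ x])
       (use p_close in \<open>simp_all add: deriv01_g abs_minus_commute\<close>, simp add: g_def)
  then have "X_dist \<alpha> f g \<le> e"
    using \<alpha> p_close sup_norm01_le[of "\<lambda>x. f x - g x" e]
      sup_norm01_le[of "\<lambda>x. deriv01 f x - deriv01 g x" e]
    by (simp add: X_dist_altdef[OF f gX] deriv01_g abs_minus_commute)
  ultimately show ?thesis by blast
qed

lemma closure_of_layers:
  assumes "0 \<le> \<alpha>" "\<alpha> < 2"
  shows "X_topology \<alpha> closure_of (\<Inter>n. convex_comb_layer \<alpha> n) = X_carrier \<alpha>"
proof -
  let ?G = "\<Inter>n. convex_comb_layer \<alpha> n"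
  interpret Metric_space "X_carrier \<alpha>" "X_dist \<alpha>"
    using assms(1) by (rule Metric_space_X)
  show ?thesis
    unfolding metric_closure_of
  proof (intro equalityI subsetI CollectI conjI allI impI)
    fix f and r :: real assume f: "f \<in> X_carrier \<alpha>" and r: "0 < r"
    obtain g where g: "g \<in> ?G" "X_dist \<alpha> f g \<le> r / 2"
      using exists_near_in_all_layers_less_1[OF assms(1) _ f, of "r/2"]
        exists_near_in_all_layers_ge_1[OF _ assms(2) f, of "r/2"] r
      by (cases "\<alpha> < 1") auto
    then have "g \<in> mball f r" using f r by (auto simp: convex_comb_layer_def)
    then show "\<exists>g\<in>?G. g \<in> mball f r" using g by blast
  qed auto
qed

section \<open>Gluing finite convex pieces at the origin\<close>

lemma tendsto_slope_at_0:
  assumes "continuous_on {0..1} f" "0 < w"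
  shows "((\<lambda>u. slope f u w) \<longlongrightarrow> slope f 0 w) (at 0 within {0..1})"
proof -
  have "(f \<longlongrightarrow> f 0) (at 0 within {0..1})"
    using assms(1) by (simp add: continuous_on_def)
  then show ?thesis
    unfolding slope_def using \<open>0 < w\<close> by (intro tendsto_intros) auto
qed

text \<open>For large \<open>m\<close>, in a triple \<open>u < v < w\<close> of \<open>B \<union> F m\<close> that is in neither of the two sets, the points from
  \<open>F m\<close> come first. If this is \<open>u\<close> alone, then the slope from \<open>u\<close> to \<open>v\<close> is almost the slope from \<open>0 \<in> B\<close> to \<open>v\<close>. If it is \<open>u\<close> and \<open>v\<close>,
  then the first slope is below \<open>L\<close>, whereas the second is almost the slope from \<open>0\<close> to \<open>w\<close>. The gap \<open>L\<close> is
  what absorbs this last error.\<close>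

lemma eventually_strictly_convex_Un:
  assumes cont: "continuous_on {0..1} f"
    and B: "finite B" "0 \<in> B" "B \<subseteq> {0..1}" "strictly_convex_restricted B f"
    and F: "\<And>m. F m \<subseteq> {0..<1 / real (Suc m)}"
    and F_convex: "\<And>m. strictly_convex_restricted (F m) f"
    and F_0: "\<And>m. 0 \<in> F m"
    and below: "\<And>w. w \<in> B \<Longrightarrow> 0 < w \<Longrightarrow> \<exists>L<slope f 0 w. \<forall>\<^sub>F m in sequentially. slopes_below L (F m) f"
  shows "\<forall>\<^sub>F m in sequentially. strictly_convex_restricted (B \<union> F m) f"
proof -
  define P where "P = B \<inter> {0<..}"
  have P: "finite P" "\<And>w. w \<in> P \<Longrightarrow> w \<in> B \<and> 0 < w"
    using B by (auto simp: P_def)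
  have "\<forall>w\<in>P. \<exists>L<slope f 0 w. \<forall>\<^sub>F m in sequentially. slopes_below L (F m) f"
    using below P by blast
  then obtain L where L: "\<And>w. w \<in> P \<Longrightarrow> L w < slope f 0 w"
    "\<And>w. w \<in> P \<Longrightarrow> \<forall>\<^sub>F m in sequentially. slopes_below (L w) (F m) f"
    by metis
  \<comment> \<open>What a point \<open>u\<close> close to \<open>0\<close> shares with \<open>0\<close> by continuity of \<open>f\<close>.\<close>
  define good where "good u \<longleftrightarrow> (\<forall>w\<in>P. L w < slope f u w) \<and>
      (\<forall>v\<in>P. \<forall>w\<in>P. v < w \<longrightarrow> slope f u v < slope f v w) \<and> (\<forall>w\<in>P. u < w)" for u
  have good0: "good 0"
    using L B(2,4) P by (auto simp: good_def intro: strictly_convex_restrictedD)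
  have lt_w: "\<forall>\<^sub>F u in at 0 within {0..1}. u < w" if "0 < w" for w :: real
    using that order_tendstoD(2)[OF tendsto_ident_at] by blast
  have "\<forall>\<^sub>F u in at 0 within {0..1}. \<forall>w\<in>P. L w < slope f u w"
    using P(1)
  proof (rule eventually_ball_finite, intro ballI)
    fix w assume "w \<in> P"
    then show "\<forall>\<^sub>F u in at 0 within {0..1}. L w < slope f u w"
      using order_tendstoD(1)[OF tendsto_slope_at_0[OF cont]] L(1) P(2) by blast
  qed
  moreover have "\<forall>\<^sub>F u in at 0 within {0..1}. \<forall>v\<in>P. \<forall>w\<in>P. v < w \<longrightarrow> slope f u v < slope f v w"
  proof (intro eventually_ball_finite P(1) ballI)
    fix v w assume vw: "v \<in> P" "w \<in> P"
    show "\<forall>\<^sub>F u in at 0 within {0..1}. v < w \<longrightarrow> slope f u v < slope f v w"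
    proof (cases "v < w")
      case True
      then have "slope f 0 v < slope f v w"
        using good0 vw by (auto simp: good_def)
      then show ?thesis
        using order_tendstoD(2)[OF tendsto_slope_at_0[OF cont]] vw(1) P(2) by simp
    qed simp
  qed
  moreover have "\<forall>\<^sub>F u in at 0 within {0..1}. \<forall>w\<in>P. u < w"
    using P by (intro eventually_ball_finite ballI lt_w) auto
  ultimately have "\<forall>\<^sub>F u in at 0 within {0..1}. good u"
    unfolding good_def by eventually_elim auto
  then obtain d where d: "d > 0" "\<And>u. u \<in> {0..1} \<Longrightarrow> u \<noteq> 0 \<Longrightarrow> dist u 0 < d \<Longrightarrow> good u"
    unfolding eventually_at by blast
  have good: "good u" if "u \<in> {0..<d}" "u \<le> 1" for u
    using d(2)[of u] good0 that by (cases "u = 0") auto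
  obtain M where M: "1 / real (Suc M) < d"
    using reals_Archimedean[OF d(1)] by (auto simp: inverse_eq_divide)
  have good_F: "good u" if "u \<in> F m" "m \<ge> M" for u m
  proof (rule good)
    have *: "0 \<le> u" "u < 1 / real (Suc m)" using F[of m] that(1) by auto
    moreover have "1 / real (Suc m) \<le> 1 / real (Suc M)" "1 / real (Suc m) \<le> 1"
      using that(2) by (auto simp: field_simps)
    ultimately show "u \<in> {0..<d}" "u \<le> 1"
      using M unfolding atLeastLessThan_iff by linarith+
  qed
  have "\<forall>\<^sub>F m in sequentially. \<forall>w\<in>P. slopes_below (L w) (F m) f"
    using P L by (intro eventually_ball_finite) auto
  moreover have "\<forall>\<^sub>F m in sequentially. m \<ge> M"
    by (rule eventually_ge_at_top)
  ultimately show ?thesis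
  proof eventually_elim
    case (elim m)
    have B_split: "x \<in> F m \<or> x \<in> P" if "x \<in> B \<union> F m" for x
      using that B(3) F_0[of m] by (cases "x = 0") (auto simp: P_def)
    show ?case
      unfolding strictly_convex_restricted_def
    proof (intro ballI impI)
      fix u v w
      assume mem: "u \<in> B \<union> F m" "v \<in> B \<union> F m" "w \<in> B \<union> F m" and lt: "u < v" "v < w"
      have above: "x < y" if "x \<in> F m" "y \<in> P" for x y
        using good_F[OF that(1) elim(2)] that(2) by (auto simp: good_def)
      have vF: "v \<in> F m" if "w \<in> F m"
        using B_split[OF mem(2)] above[OF that] lt by fastforce
      have uF: "u \<in> F m" if "v \<in> F m"
        using B_split[OF mem(1)] above[OF that] lt by fastforce
      consider "w \<in> F m" | "v \<in> F m" "w \<in> P" | "u \<in> F m" "v \<in> P" "w \<in> P" | "u \<in> P" "v \<in> P" "w \<in> P"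
        using B_split mem vF uF by blast
      then show "slope f u v < slope f v w"
      proof cases
        case 1
        then show ?thesis
          using vF uF lt F_convex[of m] by (auto intro: strictly_convex_restrictedD)
      next
        case 2
        then have "slope f u v < L w"
          using uF lt elim(1) by (auto intro: slopes_belowD)
        also have "L w < slope f v w"
          using good_F[OF 2(1) elim(2)] 2 by (auto simp: good_def)
        finally show ?thesis .
      next
        case 3
        then show ?thesis
          using good_F[OF 3(1) elim(2)] lt by (auto simp: good_def)
      next
        case 4
        then show ?thesis
          using P(2) B(4) lt by (auto intro: strictly_convex_restrictedD)
      qed
    qed
  qed
qed

lemma closed_if_finite_away_from_0:
  fixes A :: "real set"
  assumes "A \<subseteq> {0..}" "0 \<in> A" and fin: "\<And>e. 0 < e \<Longrightarrow> finite (A \<inter> {e<..})"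
  shows "closed A"
  unfolding closed_limpt
proof (intro allI impI)
  fix x assume x: "x islimpt A"
  have "x \<in> closure A"
    using x by (simp add: closure_def)
  moreover have "closure A \<subseteq> {0..}"
    using assms(1) by (intro closure_minimal) auto
  ultimately have "0 \<le> x" by auto
  moreover have "\<not> 0 < x"
  proof
    assume "0 < x"
    then have "A \<inter> ball x (x/2) \<subseteq> A \<inter> {x/3<..}"
      by (auto simp: dist_real_def abs_if field_simps split: if_splits)
    then have "finite (A \<inter> ball x (x/2))"
      by (rule finite_subset) (use fin[of "x/3"] \<open>0 < x\<close> in simp)
    moreover have "infinite (A \<inter> ball x (x/2))"
      using x \<open>0 < x\<close> unfolding islimpt_eq_infinite_ball by simp
    ultimately show False by blast
  qed
  ultimately show "x \<in> A" using \<open>0 \<in> A\<close> by simp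
qed

text \<open>The sets \<open>F m\<close> are added one at a time, skipping those that come too early. All \<open>F m\<close> shrink to \<open>0\<close>, so
  the union has no other limit point.\<close>

lemma exists_convex_union:
  assumes cont: "continuous_on {0..1} f"
    and F: "\<And>m. finite (F m)" "\<And>m. F m \<subseteq> {0..<1 / real (Suc m)}"
    and F_0: "\<And>m. 0 \<in> F m"
    and F_convex: "\<And>m. strictly_convex_restricted (F m) f"
    and below: "\<And>n w. w \<in> F n \<Longrightarrow> 0 < w \<Longrightarrow>
                  \<exists>L<slope f 0 w. \<forall>\<^sub>F m in sequentially. slopes_below L (F m) f"
  shows "\<exists>A\<subseteq>{0..1}. closed A \<and> convex_restricted A f \<and> (\<forall>M. \<exists>m\<ge>M. F m \<subseteq> A)"
proof -
  \<comment> \<open>The gap property of each \<open>F n\<close> is inherited by unions, so it can be part of the invariant.\<close>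
  define ok where "ok B \<longleftrightarrow> finite B \<and> 0 \<in> B \<and> B \<subseteq> {0..1} \<and> strictly_convex_restricted B f \<and>
      (\<forall>w\<in>B. 0 < w \<longrightarrow> (\<exists>L<slope f 0 w. \<forall>\<^sub>F m in sequentially. slopes_below L (F m) f))" for B
  have F01: "F m \<subseteq> {0..1}" for m
  proof -
    have "1 / real (Suc m) \<le> 1" by simp
    then have "{0..<1 / real (Suc m)} \<subseteq> {0..1}"
      by (meson atLeastLessThan_subseteq_atLeastAtMost_iff order_refl)
    then show ?thesis using F(2)[of m] by blast
  qed
  have "\<exists>B. \<forall>n. ok (B n) \<and> (\<exists>m\<ge>n. B (Suc n) = B n \<union> F m)"
  proof (rule dependent_nat_choice)
    show "\<exists>B. ok B"
      using F F_0 F_convex F01 below by (intro exI[of _ "F 0"]) (auto simp: ok_def)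
  next
    fix B n assume B: "ok B"
    have "\<forall>\<^sub>F m in sequentially. strictly_convex_restricted (B \<union> F m) f"
      using B by (intro eventually_strictly_convex_Un cont F F_convex F_0) (auto simp: ok_def)
    then obtain M where "\<And>m. m \<ge> M \<Longrightarrow> strictly_convex_restricted (B \<union> F m) f"
      unfolding eventually_sequentially by blast
    then have "strictly_convex_restricted (B \<union> F (max M n)) f" by simp
    then have "ok (B \<union> F (max M n))"
      using B F F01 below by (auto simp: ok_def)
    then show "\<exists>C. ok C \<and> (\<exists>m\<ge>n. C = B \<union> F m)"
      by (intro exI[of _ "B \<union> F (max M n)"] conjI exI[of _ "max M n"]) simp_all
  qed
  then obtain B where B: "\<And>n. ok (B n)" and B_Suc: "\<And>n. \<exists>m\<ge>n. B (Suc n) = B n \<union> F m"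
    by blast
  have mono: "B i \<subseteq> B j" if "i \<le> j" for i j
  proof (rule lift_Suc_mono_le[OF _ that])
    show "B n \<subseteq> B (Suc n)" for n
      using B_Suc[of n] by blast
  qed
  define A where "A = (\<Union>n. B n)"
  have "A \<subseteq> {0..1}" "0 \<in> A"
    using B by (auto simp: A_def ok_def)
  moreover have "closed A"
  proof (rule closed_if_finite_away_from_0)
    fix e :: real assume "0 < e"
    then obtain M where M: "1 / real (Suc M) < e"
      using reals_Archimedean by (auto simp: inverse_eq_divide)
    have "B n \<inter> {e<..} \<subseteq> B M" for n
    proof (induction n)
      case 0
      then show ?case using mono[of 0 M] by auto
    next
      case (Suc n)
      show ?case
      proof (cases "Suc n \<le> M")
        case True
        then show ?thesis using mono by blast
      next
        case False
        obtain m where m: "m \<ge> n" "B (Suc n) = B n \<union> F m" using B_Suc by blast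
        have "1 / real (Suc m) \<le> 1 / real (Suc M)"
          using False m(1) by (auto simp: field_simps)
        then have "\<not> e < x" if "x \<in> F m" for x
          using subsetD[OF F(2) that] M by (simp del: of_nat_Suc)
        then have "F m \<inter> {e<..} = {}" by blast
        then show ?thesis using Suc m(2) by auto
      qed
    qed
    then have "A \<inter> {e<..} \<subseteq> B M" by (auto simp: A_def)
    then show "finite (A \<inter> {e<..})"
      using B[of M] by (auto simp: ok_def intro: finite_subset)
  qed (use \<open>A \<subseteq> {0..1}\<close> \<open>0 \<in> A\<close> in auto)
  moreover have "convex_restricted A f"
    unfolding convex_restricted_def
  proof (intro ballI impI)
    fix u v w assume uvw: "u \<in> A" "v \<in> A" "w \<in> A" "u < v" "v < w"
    then obtain i j k where "u \<in> B i" "v \<in> B j" "w \<in> B k" by (auto simp: A_def)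
    then have "u \<in> B (max i (max j k))" "v \<in> B (max i (max j k))" "w \<in> B (max i (max j k))"
      using mono by (meson max.cobounded1 max.cobounded2 order_trans subsetD)+
    then have "slope f u v < slope f v w"
      using B uvw by (auto simp: ok_def intro: strictly_convex_restrictedD)
    then show "(f v - f u) / (v - u) \<le> (f w - f v) / (w - v)"
      by (simp add: slope_def)
  qed
  moreover have "\<exists>m\<ge>M. F m \<subseteq> A" for M
    using B_Suc[of M] by (auto simp: A_def)
  ultimately show ?thesis by blast
qed

section \<open>Box dimension of sets containing many combs\<close>

definition box_indices :: "nat \<Rightarrow> nat \<Rightarrow> real set \<Rightarrow> int set" where
  "box_indices k l A =
     {j::int. A \<inter> {(real_of_int j - 1) / real k ^ l .. real_of_int j / real k ^ l} \<noteq> {}}"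

lemma box_indices_subset:
  assumes "A \<subseteq> {0..1}" "k \<ge> 2"
  shows "box_indices k l A \<subseteq> {0..int (k ^ l) + 1}"
proof
  fix j assume "j \<in> box_indices k l A"
  then obtain x where x: "x \<in> A" "(real_of_int j - 1) / real k ^ l \<le> x" "x \<le> real_of_int j / real k ^ l"
    by (auto simp: box_indices_def)
  have "0 < real k ^ l" using assms by simp
  moreover have "0 \<le> x" "x \<le> 1" using assms x by auto
  ultimately have "0 / real k ^ l \<le> real_of_int j / real k ^ l" "(real_of_int j - 1) / real k ^ l \<le> 1"
    using x by (simp, meson order_trans)
  then have "0 \<le> real_of_int j" "real_of_int j - 1 \<le> real k ^ l"
    using \<open>0 < real k ^ l\<close> by (simp_all add: pos_divide_le_eq zero_le_divide_iff)
  then have "real_of_int j \<le> real_of_int (int (k ^ l) + 1)" by simp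
  then show "j \<in> {0..int (k ^ l) + 1}"
    using \<open>0 \<le> real_of_int j\<close> by (simp only: of_int_le_iff) simp
qed

text \<open>The crude factor \<open>k\<^sup>2\<close> turns the bound \<open>k\<^sup>l + 2\<close> into a power of \<open>k\<close>, whose logarithm is explicit; it does
  not affect the limit.\<close>

lemma box_count_le:
  assumes "A \<subseteq> {0..1}" "k \<ge> 2"
  shows "box_count k l A \<le> k ^ (l + 2)"
proof -
  have "box_count k l A \<le> card {0..int (k ^ l) + 1}"
    unfolding box_count_def box_indices_def[symmetric]
    using box_indices_subset[OF assms] by (intro card_mono) auto
  also have "\<dots> = k ^ l + 2" by (simp add: nat_add_distrib nat_power_eq)
  also have "\<dots> \<le> 4 * k ^ l"
    using assms(2) one_le_power[of k l] by linarith
  also have "\<dots> \<le> k ^ 2 * k ^ l"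
    using power_mono[OF assms(2), of 2] by (intro mult_right_mono) auto
  finally show ?thesis by (simp only: power_add mult.commute)
qed

text \<open>Neighbouring teeth are at least one box length apart, so rounding them up to multiples of that
  length gives pairwise different boxes.\<close>

lemma box_count_ge_comb:
  assumes A: "A \<subseteq> {0..1}" "k \<ge> 2" and comb: "comb h N \<subseteq> A" and h: "1 \<le> h * real k ^ l"
  shows "N \<le> box_count k l A"
proof -
  let ?j = "\<lambda>i. \<lceil>real i * (h * real k ^ l)\<rceil>"
  have "strict_mono ?j"
  proof (rule strict_mono_Suc_iff[THEN iffD2], rule allI)
    fix i
    have "?j i + 1 = \<lceil>real i * (h * real k ^ l) + 1\<rceil>" by simp
    also have "\<dots> \<le> ?j (Suc i)" using h by (intro ceiling_mono) (simp add: algebra_simps)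
    finally show "?j i < ?j (Suc i)" by simp
  qed
  then have "inj_on ?j {0..N}" by (meson inj_on_subset strict_mono_imp_inj_on subset_UNIV)
  then have "card {0..N} = card (?j ` {0..N})" by (simp add: card_image)
  also have "\<dots> \<le> card (box_indices k l A)"
  proof (rule card_mono)
    show "finite (box_indices k l A)"
      using box_indices_subset[OF A] finite_subset by blast
    show "?j ` {0..N} \<subseteq> box_indices k l A"
    proof clarify
      fix i assume "i \<in> {0..N}"
      then have "real i * h \<in> A" using comb unfolding comb_def by blast
      moreover have "0 < real k ^ l" using A(2) by simp
      then have "(real_of_int (?j i) - 1) / real k ^ l \<le> real i * h" "real i * h \<le> real_of_int (?j i) / real k ^ l"
        using ceiling_correct[of "real i * (h * real k ^ l)"] by (auto simp: field_simps)
      ultimately show "?j i \<in> box_indices k l A" by (auto simp: box_indices_def)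
    qed
  qed
  finally show ?thesis by (simp add: box_count_def box_indices_def)
qed

lemma upper_box_dim_le_1:
  assumes A: "A \<subseteq> {0..1}" "k \<ge> 2"
  shows "upper_box_dim k A \<le> 1"
proof -
  have "(\<lambda>l. 1 + 2 / real l) \<longlonglongrightarrow> 1 + 0"
    by (intro tendsto_add tendsto_const lim_const_over_n)
  moreover have "\<forall>\<^sub>F l in sequentially. 1 + 2 / real l = (real l + 2) / real l"
    using eventually_gt_at_top[of 0] by eventually_elim (simp add: field_simps)
  ultimately have "(\<lambda>l. (real l + 2) / real l) \<longlonglongrightarrow> 1"
    by (simp add: tendsto_cong)
  then have "(\<lambda>l. ereal ((real l + 2) / real l)) \<longlonglongrightarrow> 1"
    by (simp add: one_ereal_def)
  then have "limsup (\<lambda>l. ereal ((real l + 2) / real l)) = 1"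
    by (intro lim_imp_Limsup) auto
  moreover have "ln (real (box_count k l A)) / (real l * ln (real k)) \<le> (real l + 2) / real l" if "l > 0" for l
  proof -
    have lnk: "0 < ln (real k)" using A by simp
    have "ln (real (box_count k l A)) \<le> ln (real (k ^ (l + 2)))"
    proof (cases "box_count k l A = 0")
      case True then show ?thesis using A(2) lnk by (simp add: ln_realpow del: power_Suc power_add_numeral2)
    next
      case False then show ?thesis
        using box_count_le[OF A, of l] A(2)
        by (subst ln_le_cancel_iff) (auto simp del: of_nat_power power_Suc power_add_numeral2)
    qed
    also have "\<dots> = (real l + 2) * ln (real k)" using A(2) by (simp add: ln_realpow del: power_Suc)
    finally have "ln (real (box_count k l A)) / (real l * ln (real k))
        \<le> ((real l + 2) * ln (real k)) / (real l * ln (real k))"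
      using lnk by (intro divide_right_mono) simp_all
    then show ?thesis using lnk by simp
  qed
  then have "upper_box_dim k A \<le> limsup (\<lambda>l. ereal ((real l + 2) / real l))"
    unfolding upper_box_dim_def
    by (intro Limsup_mono eventually_mono[OF eventually_gt_at_top[of 0]]) simp
  ultimately show ?thesis by simp
qed

text \<open>Take the first scale whose boxes are not longer than \<open>h\<close>. Its box length is within the factor \<open>k\<close> of \<open>h\<close>.\<close>

lemma exists_scale_of_gap:
  assumes k: "k \<ge> 2" and h: "0 < h" "h < 1"
  obtains l where "1 \<le> h * real k ^ l" "real l * ln (real k) < ln (1 / h) + ln (real k)" "ln (1/h) \<le> real l * ln (real k)"
proof -
  have lnk: "0 < ln (real k)" using k by simp
  have ln1: "0 < ln (1/h)" using h by simp
  define l where "l = nat \<lceil>ln (1/h) / ln (real k)\<rceil>"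
  have 1: "ln (1/h) / ln (real k) \<le> real l" unfolding l_def by (simp add: real_nat_ceiling_ge)
  have "0 \<le> ln (1/h) / ln (real k)" using lnk ln1 by simp
  then have 2: "real l < ln (1/h) / ln (real k) + 1"
    unfolding l_def by linarith
  have 3: "ln (1/h) \<le> real l * ln (real k)" using 1 lnk by (simp add: divide_simps)
  also have "\<dots> = ln (real k ^ l)" using k by (simp add: ln_realpow)
  finally have "1/h \<le> real k ^ l" using k h by (subst (asm) ln_le_cancel_iff) auto
  then have "1 \<le> h * real k ^ l" using h by (simp add: divide_simps mult.commute)
  moreover have "real l * ln (real k) < ln (1 / h) + ln (real k)"
    using 2 lnk by (simp add: field_simps)
  ultimately show ?thesis using 3 that by blast
qed

text \<open>At a scale \<open>l\<close> matching the gap \<open>h\<close>, the quotient in the definition of the dimension is at least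
  \<open>n/(n+1)\<close> times \<open>ln (1/h) / (ln (1/h) + ln k)\<close>. Since \<open>1/h > n\<close>, the latter tends to \<open>1\<close>, uniformly in the
  choice of the combs.\<close>

lemma upper_box_dim_ge_1:
  assumes A: "A \<subseteq> {0..1}" "k \<ge> 2"
    and combs: "\<And>M. \<exists>n\<ge>M. \<exists>N h. 0 < h \<and> real N * h < 1 / real (Suc n) \<and> (1/h) ^ n \<le> real N ^ Suc n \<and> comb h N \<subseteq> A"
  shows "1 \<le> upper_box_dim k A"
proof (rule ccontr)
  assume "\<not> ?thesis"
  then obtain c where c: "upper_box_dim k A < ereal c" "ereal c < 1"
    using ereal_dense2[of "upper_box_dim k A" 1] not_le by blast
  define K where "K = ln (real k)"
  have K: "0 < K" using A by (simp add: K_def)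
  \<comment> \<open>The quotients at all large scales stay below \<open>c < 1\<close>; a comb with large \<open>n\<close> contradicts this.\<close>
  obtain l0 where l0: "\<And>l. l \<ge> l0 \<Longrightarrow> ln (real (box_count k l A)) / (real l * K) < c"
    using Limsup_lessD[OF c(1)[unfolded upper_box_dim_def]]
    by (auto simp: eventually_sequentially K_def)
  have ln_top: "filterlim (\<lambda>n. ln (real n)) at_top sequentially"
    by (rule filterlim_compose[OF ln_at_top filterlim_real_sequentially])
  have "(\<lambda>n. K / (ln (real n) + K)) \<longlonglongrightarrow> 0"
    using filterlim_tendsto_add_at_top[OF tendsto_const ln_top, of K]
    by (intro real_tendsto_divide_at_top[OF tendsto_const]) (simp add: add.commute)
  then have "(\<lambda>n. (real n / real (Suc n)) * (1 - K / (ln (real n) + K))) \<longlonglongrightarrow> 1 * (1 - 0)"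
    by (intro tendsto_mult tendsto_diff tendsto_const LIMSEQ_n_over_Suc_n)
  then have "(\<lambda>n. (real n / real (Suc n)) * (1 - K / (ln (real n) + K))) \<longlonglongrightarrow> 1" by simp
  moreover have "c < 1" using c by (simp add: one_ereal_def)
  ultimately have "\<forall>\<^sub>F n in sequentially. c < (real n / real (Suc n)) * (1 - K / (ln (real n) + K))"
    by (rule order_tendstoD)
  moreover have "\<forall>\<^sub>F n in sequentially. ln (real n) \<ge> real l0 * K"
    using ln_top by (simp add: filterlim_at_top)
  moreover have "\<forall>\<^sub>F n in sequentially. n \<ge> (2::nat)" by (rule eventually_ge_at_top)
  ultimately have "\<forall>\<^sub>F n in sequentially. c < (real n / real (Suc n)) * (1 - K / (ln (real n) + K))
      \<and> ln (real n) \<ge> real l0 * K \<and> n \<ge> 2"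
    by eventually_elim auto
  then obtain M where M: "\<And>n. n \<ge> M \<Longrightarrow> c < (real n / real (Suc n)) * (1 - K / (ln (real n) + K))
      \<and> ln (real n) \<ge> real l0 * K \<and> n \<ge> 2"
    unfolding eventually_sequentially by blast
  obtain n N h where n: "n \<ge> M" and h: "0 < h" and Nh: "real N * h < 1 / real (Suc n)"
    and N: "(1/h) ^ n \<le> real N ^ Suc n" and cA: "comb h N \<subseteq> A"
    using combs[of M] by blast
  note Mn = M[OF n]
  have "N \<ge> 1"
  proof (rule ccontr)
    assume "\<not> ?thesis"
    then have "(1/h) ^ n \<le> 0" using N by (simp add: not_le)
    moreover have "0 < (1/h) ^ n" using h by simp
    ultimately show False by linarith
  qed
  then have "1 * h \<le> real N * h" using h by (intro mult_right_mono) auto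
  then have h_less: "h < 1 / real (Suc n)" using Nh by simp
  then have nh: "real n < 1/h" using h by (simp add: field_simps)
  have "1 / real (Suc n) \<le> 1" by simp
  with h_less have h1: "h < 1" by linarith
  have lnn: "ln (real n) \<le> ln (1/h)" "0 < ln (real n)" using nh Mn h by (auto intro!: ln_mono)
  obtain l where l: "1 \<le> h * real k ^ l" "real l * K < ln (1 / h) + K" "ln (1/h) \<le> real l * K"
    using exists_scale_of_gap[OF A(2) h h1] unfolding K_def by blast
  have "real l0 * K \<le> real l * K" using l(3) lnn Mn by linarith
  then have "l \<ge> l0" using K by simp
  have lpos: "0 < real l * K" using l(3) lnn by linarith
  have "N \<le> box_count k l A" by (rule box_count_ge_comb[OF A cA l(1)])
  have "real n * ln (1/h) = ln ((1/h) ^ n)" using h by (simp add: ln_realpow)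
  also have "\<dots> \<le> ln (real N ^ Suc n)"
    using N h by (subst ln_le_cancel_iff) (use \<open>N \<ge> 1\<close> in \<open>auto intro!: zero_less_power simp del: power_Suc\<close>)
  also have "\<dots> = real (Suc n) * ln (real N)" using \<open>N \<ge> 1\<close> by (subst ln_realpow) auto
  also have "\<dots> \<le> real (Suc n) * ln (real (box_count k l A))"
    using \<open>N \<le> box_count k l A\<close> \<open>N \<ge> 1\<close> by (intro mult_left_mono) auto
  finally have up: "real n / real (Suc n) * ln (1/h) \<le> ln (real (box_count k l A))"
    by (simp add: divide_simps mult.commute)
  have frac: "1 - K / (ln (real n) + K) \<le> ln (1/h) / (real l * K)"
  proof -
    have "1 - K / (ln (real n) + K) \<le> 1 - K / (ln (1/h) + K)"
      using lnn K by (auto intro!: divide_left_mono)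
    also have "\<dots> = ln (1/h) / (ln (1/h) + K)" using lnn K by (simp add: field_simps)
    also have "\<dots> \<le> ln (1/h) / (real l * K)" using l(2) lnn lpos by (intro divide_left_mono) auto
    finally show ?thesis .
  qed
  have "c < (real n / real (Suc n)) * (1 - K / (ln (real n) + K))" using Mn by blast
  also have "\<dots> \<le> (real n / real (Suc n)) * (ln (1/h) / (real l * K))"
    using frac by (intro mult_left_mono) auto
  also have "\<dots> \<le> ln (real (box_count k l A)) / (real l * K)"
    using divide_right_mono[OF up, of "real l * K"] lpos by (simp del: of_nat_Suc)
  finally show False using l0[OF \<open>l \<ge> l0\<close>] by simp
qed

section \<open>Convex sets of dimension 1\<close>

text \<open>For \<open>\<alpha> < 1\<close> the slopes on \<open>F m\<close> are below \<open>- m\<close>. For \<open>\<alpha> \<ge> 1\<close> they are values of \<open>f'\<close> close to \<open>0\<close>, hence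
  close to \<open>f'(0)\<close>, while the slope from \<open>0\<close> to \<open>w\<close> exceeds \<open>f'(0)\<close> strictly.\<close>

lemma eventually_slopes_below:
  assumes \<alpha>: "0 \<le> \<alpha>" and f: "f \<in> X_carrier \<alpha>"
    and F: "\<And>m. F m \<subseteq> {0..<1 / real (Suc m)}" and steep: "\<And>m. steep_on \<alpha> m (F m) f"
    and w: "w \<in> F n" "0 < w"
  shows "\<exists>L<slope f 0 w. \<forall>\<^sub>F m in sequentially. slopes_below L (F m) f"
proof (cases "\<alpha> < 1")
  case True
  obtain M where M: "- (slope f 0 w - 1) \<le> real M" using real_arch_simple by blast
  have "slopes_below (slope f 0 w - 1) (F m) f" if "m \<ge> M" for m
    using steep[of m] that True M by (force simp: steep_on_def slopes_below_def)
  then show ?thesis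
    by (intro exI[of _ "slope f 0 w - 1"]) (auto simp: eventually_sequentially)
next
  case False
  define L where "L = (deriv01 f 0 + slope f 0 w) / 2"
  have "deriv01 f 0 < slope f 0 w" using steep[of n] w False by (auto simp: steep_on_def)
  then have L: "deriv01 f 0 < L" "L < slope f 0 w" by (auto simp: L_def)
  have "(deriv01 f \<longlongrightarrow> deriv01 f 0) (at 0 within {0..1})"
    using X_carrier_continuous_deriv01[of \<alpha> f] f False by (simp add: continuous_on_def)
  then have "\<forall>\<^sub>F x in at 0 within {0..1}. deriv01 f x < L" using L(1) by (rule order_tendstoD)
  then obtain \<delta> where \<delta>: "\<delta> > 0" "\<And>x. x \<in> {0..1} \<Longrightarrow> x \<noteq> 0 \<Longrightarrow> dist x 0 < \<delta> \<Longrightarrow> deriv01 f x < L"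
    unfolding eventually_at by blast
  obtain M where M: "1 / real (Suc M) < \<delta>"
    using reals_Archimedean[OF \<delta>(1)] by (auto simp: inverse_eq_divide)
  have "slopes_below L (F m) f" if "m \<ge> M" for m
    unfolding slopes_below_def
  proof (intro ballI impI)
    fix u v assume uv: "u \<in> F m" "v \<in> F m" "u < v"
    then have *: "0 \<le> u" "v < 1 / real (Suc m)" using F[of m] by auto
    moreover have "1 / real (Suc m) \<le> 1" "1 / real (Suc m) \<le> 1 / real (Suc M)"
      using that by (auto simp: field_simps)
    ultimately have v: "v < 1" "v < \<delta>" using M by linarith+
    have "continuous_on {u..v} f"
      using X_carrier_continuous[OF \<alpha> f] by (rule continuous_on_subset) (use * v in auto)
    moreover have "(f has_real_derivative deriv01 f x) (at x)" if "u < x" "x < v" for x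
      using deriv01_works[of f x] X_carrier_differentiable[of \<alpha> f] f False that * v
      by (simp add: has_real_derivative_iff_has_vector_derivative at_within_Icc_at)
    ultimately obtain z where z: "u < z" "z < v" "slope f u v = deriv01 f z"
      using slope_eq_derivative[of u v f "deriv01 f"] uv(3) by blast
    then show "slope f u v < L" using \<delta>(2)[of z] * v by auto
  qed
  then show ?thesis using L by (auto simp: eventually_sequentially)
qed

lemma exists_convex_set_of_dim_1:
  assumes "0 \<le> \<alpha>" and "f \<in> (\<Inter>n. convex_comb_layer \<alpha> n)"
  shows "\<exists>A. A \<subseteq> {0..1} \<and> closed A \<and> convex_restricted A f \<and> (\<forall>k\<ge>2. upper_box_dim k A = 1)"
proof -
  have f: "f \<in> X_carrier \<alpha>" and "\<And>n. \<exists>N h. fine_comb n h N \<and>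
      strictly_convex_restricted (comb h N) f \<and> steep_on \<alpha> n (comb h N) f"
    using assms(2) by (auto simp: convex_comb_layer_def)
  then obtain N h where Nh: "\<And>n. fine_comb n (h n) (N n)"
      "\<And>n. strictly_convex_restricted (comb (h n) (N n)) f" "\<And>n. steep_on \<alpha> n (comb (h n) (N n)) f"
    by metis
  have "\<exists>A\<subseteq>{0..1}. closed A \<and> convex_restricted A f \<and> (\<forall>M. \<exists>m\<ge>M. comb (h m) (N m) \<subseteq> A)"
  proof (rule exists_convex_union)
    fix n w assume "w \<in> comb (h n) (N n)" "0 < w"
    then show "\<exists>L<slope f 0 w. \<forall>\<^sub>F m in sequentially. slopes_below L (comb (h m) (N m)) f"
      by (rule eventually_slopes_below[OF assms(1) f comb_subset[OF Nh(1)] Nh(3)])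
  qed (intro X_carrier_continuous[OF assms(1) f] finite_comb comb_subset[OF Nh(1)] zero_in_comb Nh(2))+
  then obtain A where A: "A \<subseteq> {0..1}" "closed A" "convex_restricted A f"
    and combs: "\<And>M. \<exists>m\<ge>M. comb (h m) (N m) \<subseteq> A"
    by auto
  have "upper_box_dim k A = 1" if "k \<ge> 2" for k
  proof (rule antisym)
    show "1 \<le> upper_box_dim k A"
    proof (rule upper_box_dim_ge_1[OF A(1) that])
      fix M
      obtain m where "m \<ge> M" "comb (h m) (N m) \<subseteq> A" using combs by blast
      then show "\<exists>n\<ge>M. \<exists>N h. 0 < h \<and> real N * h < 1 / real (Suc n) \<and> (1/h) ^ n \<le> real N ^ Suc n
          \<and> comb h N \<subseteq> A"
        using Nh(1)[of m] unfolding fine_comb_def by blast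
    qed
  qed (rule upper_box_dim_le_1[OF A(1) that])
  then show ?thesis using A by blast
qed

theorem theorem6:
  fixes \<alpha> :: real
  assumes "0 \<le> \<alpha>" and "\<alpha> < 2"
  shows "\<exists>\<G>. gdelta_in (X_topology \<alpha>) \<G> \<and>
              X_topology \<alpha> closure_of \<G> = X_carrier \<alpha> \<and>
              (\<forall>f\<in>\<G>. \<exists>A. A \<subseteq> {0..1} \<and> closed A \<and> convex_restricted A f \<and>
                         (\<forall>k\<ge>2. upper_box_dim k A = 1))"
proof (rule exI[of _ "\<Inter>n. convex_comb_layer \<alpha> n"], intro conjI ballI)
  show "gdelta_in (X_topology \<alpha>) (\<Inter>n. convex_comb_layer \<alpha> n)"
    using assms(1) by (intro gdelta_in_Inter) (auto intro: open_imp_gdelta_in openin_convex_comb_layer)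
  show "X_topology \<alpha> closure_of (\<Inter>n. convex_comb_layer \<alpha> n) = X_carrier \<alpha>"
    using assms by (rule closure_of_layers)
  show "\<exists>A. A \<subseteq> {0..1} \<and> closed A \<and> convex_restricted A f \<and> (\<forall>k\<ge>2. upper_box_dim k A = 1)"
    if "f \<in> (\<Inter>n. convex_comb_layer \<alpha> n)" for f
    using assms(1) that by (rule exists_convex_set_of_dim_1)
qed

end
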